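(* For each positive integer $n$, let $C_n$ be the set of $n\times n$ permutation matrices $\alpha$ such that the coefficient of the monomial $z^{\alpha}=\prod_{i,j} z_{i,j}^{\alpha_{i,j}}$ in the bitableau $[P_\alpha\mid Q_\alpha]$ is $0$. Then \[\lim_{n\to\infty}\frac{|C_n|}{n!}=1.\]
   Context: Let $z_{i,j}$ ($i,j\ge1$) be commuting indeterminates. For an $n\times n$ permutation matrix $\alpha$, let $w_\alpha=w_1\cdots w_n\in S_n$ be defined by $\alpha_{w_i,i}=1$ for all $i$, so $z^\alpha=z_{w_1,1}z_{w_2,2}\cdots z_{w_n,n}$. The pair $(P_\alpha,Q_\alpha)$ (the RSK image of $\alpha$) is obtained as follows: $P_\alpha$ is the Schensted insertion tableau of $w_\alpha$ (insert $w_1,\dots,w_n$ successively; a number $x$ inserted into a row is appended if larger than all entries, otherwise it replaces the smallest larger entry $y$, which is inserted into the next row up in the same way; French notation), and $Q_\alpha$ is the recording tableau: whenever step $i$ creates a new box in the insertion tableau, a box containing $i$ is created in the same position of $Q_\alpha$. For a pair $(P,Q)$ of standard Young tableaux of the same shape $\lambda$, for each column $j$ ($1\le j\le\lambda_1$) let $\Delta_j$ be the determinant of the square submatrix of the infinite matrix $(z_{i,k})_{i,k\ge1}$ whose rows are indexed by the entries of column $j$ of $P$ and whose columns are indexed by the entries of column $j$ of $Q$ (both in increasing order). The bitableau is $[P\mid Q]=\prod_j\Delta_j$. *)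

theory Defs
  imports
    Complex_Main
    "HOL-Library.Poly_Mapping"
    "Jordan_Normal_Form.Determinant"
begin

text \<open>
  Integer polynomials in the commuting indeterminates \<open>z i j\<close>: finitely supported maps from
  exponent vectors to coefficients.  The indices \<open>i, j\<close> are those of the mathematical text
  and start at 1, whereas matrices (\<open>mat\<close>), lists and tableau columns are indexed from 0.
\<close>

type_synonym zexp = "(nat \<times> nat) \<Rightarrow>\<^sub>0 nat"
type_synonym zpoly = "zexp \<Rightarrow>\<^sub>0 int"

definition z :: "nat \<Rightarrow> nat \<Rightarrow> zpoly" where
  "z i j = Poly_Mapping.single (Poly_Mapping.single (i, j) 1) 1"

definition mat_exp :: "nat mat \<Rightarrow> zexp" where
  "mat_exp \<alpha> =
     (\<Sum>i<dim_row \<alpha>. \<Sum>j<dim_col \<alpha>. Poly_Mapping.single (Suc i, Suc j) (\<alpha> $$ (i, j)))"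

lemma z_power: "z i j ^ k = Poly_Mapping.single (Poly_Mapping.single (i, j) k) 1"
  by (induction k) (auto simp: z_def mult_single single_add[symmetric])

lemma prod_monomials:
  fixes f :: "'a \<Rightarrow> zexp"
  assumes "finite A"
  shows "(\<Prod>a\<in>A. Poly_Mapping.single (f a) (1::int)) = Poly_Mapping.single (sum f A) 1"
  using assms by (induction A rule: finite_induct) (auto simp: mult_single)

lemma monomial_mat_exp:
  "Poly_Mapping.single (mat_exp \<alpha>) 1 =
     (\<Prod>i<dim_row \<alpha>. \<Prod>j<dim_col \<alpha>. z (Suc i) (Suc j) ^ (\<alpha> $$ (i, j)))"
  by (simp add: z_power prod_monomials mat_exp_def)

definition coeff_of_mat :: "zpoly \<Rightarrow> nat mat \<Rightarrow> int" where
  "coeff_of_mat p \<alpha> = Poly_Mapping.lookup p (mat_exp \<alpha>)"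

definition permutation_matrices :: "nat \<Rightarrow> nat mat set" where
  "permutation_matrices n =
     {\<alpha> \<in> carrier_mat n n.
        (\<forall>i<n. \<forall>j<n. \<alpha> $$ (i, j) \<in> {0, 1}) \<and>
        (\<forall>i<n. \<exists>!j. j < n \<and> \<alpha> $$ (i, j) = 1) \<and>
        (\<forall>j<n. \<exists>!i. i < n \<and> \<alpha> $$ (i, j) = 1)}"

definition perm_word :: "nat mat \<Rightarrow> nat list" where
  "perm_word \<alpha> =
     map (\<lambda>j. Suc (THE i. i < dim_row \<alpha> \<and> \<alpha> $$ (i, j) = 1)) [0..<dim_col \<alpha>]"

text \<open>
  A tableau is the list of its rows; in French notation the head of the list is the bottom row.
\<close>

type_synonym tableau = "nat list list"

text \<open>
  Schensted insertion of a number not occurring in the tableau.  The second component of the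
  result is the (0-based) index of the row at whose end the new box has been created.
\<close>

fun schensted_insert :: "nat \<Rightarrow> tableau \<Rightarrow> tableau \<times> nat" where
  "schensted_insert x [] = ([[x]], 0)"
| "schensted_insert x (r # rs) =
     (if \<forall>y\<in>set r. y < x then ((r @ [x]) # rs, 0)
      else let y = Min {y \<in> set r. x < y};
               (rs', k) = schensted_insert y rs
           in (map (\<lambda>e. if e = y then x else e) r # rs', Suc k))"

definition add_box :: "nat \<Rightarrow> nat \<Rightarrow> tableau \<Rightarrow> tableau" where
  "add_box k m T = (if k < length T then T[k := T ! k @ [m]] else T @ [[m]])"

fun rsk_step :: "nat \<times> nat \<Rightarrow> tableau \<times> tableau \<Rightarrow> tableau \<times> tableau" where
  "rsk_step (i, x) (P, Q) = (let (P', k) = schensted_insert x P in (P', add_box k i Q))"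

definition rsk :: "nat list \<Rightarrow> tableau \<times> tableau" where
  "rsk w = fold rsk_step (zip [1..<Suc (length w)] w) ([], [])"

definition P_tab :: "nat mat \<Rightarrow> tableau" where
  "P_tab \<alpha> = fst (rsk (perm_word \<alpha>))"

definition Q_tab :: "nat mat \<Rightarrow> tableau" where
  "Q_tab \<alpha> = snd (rsk (perm_word \<alpha>))"

definition num_columns :: "tableau \<Rightarrow> nat" where
  "num_columns T = (case T of [] \<Rightarrow> 0 | r # _ \<Rightarrow> length r)"

definition column :: "tableau \<Rightarrow> nat \<Rightarrow> nat list" where
  "column T j = map (\<lambda>r. r ! j) (filter (\<lambda>r. j < length r) T)"

definition z_minor :: "nat list \<Rightarrow> nat list \<Rightarrow> zpoly" where
  "z_minor rs cs = det (mat (length rs) (length cs) (\<lambda>(a, b). z (rs ! a) (cs ! b)))"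

definition bitableau :: "tableau \<Rightarrow> tableau \<Rightarrow> zpoly" where
  "bitableau P Q = (\<Prod>j<num_columns P. z_minor (sort (column P j)) (sort (column Q j)))"

definition C :: "nat \<Rightarrow> nat mat set" where
  "C n = {\<alpha> \<in> permutation_matrices n.
            coeff_of_mat (bitableau (P_tab \<alpha>) (Q_tab \<alpha>)) \<alpha> = 0}"

end

theory Submission
  imports
    Defs
    "HOL-Library.Sublist"
    "HOL-Combinatorics.Permutations"
    "HOL-Real_Asymp.Real_Asymp"
begin

text \<open>
  If the coefficient is nonzero, then \<open>w\<close> maps the set \<open>A\<close> of entries of the first column of \<open>Q\<close> onto
  the set \<open>B\<close> of entries of the first column of \<open>P\<close>.  By Schensted's theorem \<open>A \<inter> {..i}\<close> and
  \<open>B \<inter> {..v}\<close> have as many elements as the longest decreasing subsequences of the first \<open>i\<close> letters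
  and of the letters up to \<open>v\<close>, respectively.  Hence if a point of the graph of \<open>w\<close> over \<open>A\<close> has rank \<open>r\<close>
  by position and rank \<open>s\<close> by value, then \<open>w\<close> has a decreasing subsequence of length \<open>r + s - 1\<close>
  through it, so \<open>r + s \<le> D + 1\<close> where \<open>D = card A = card B\<close>.  Summation over all points forces
  equality throughout: the graph of \<open>w\<close> over \<open>A\<close> is decreasing, and for every \<open>v\<close> it contains a longest
  decreasing subsequence of the letters up to \<open>v\<close>.

  This fails for almost all \<open>w\<close>.  Typically the monotone subsequences of the letters up to \<open>v\<close> have
  length \<open>O(sqrt v)\<close>, so the longest decreasing one has length of order \<open>sqrt v\<close>.  For a
  geometric sequence of values \<open>v\<close> with large ratio, the graph over \<open>A\<close> therefore has of order
  \<open>sqrt v\<close> points in the slab between two consecutive values; typically these are spread over a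
  fixed fraction of the \<open>n\<close> positions.  As the graph is decreasing, distinct slabs occupy disjoint
  ranges of positions, and a large constant number of slabs gives a contradiction.
\<close>

section \<open>The first column of the insertion tableau\<close>

lemma subseq_snoc_iff:
  "subseq xs (w @ [x]) \<longleftrightarrow> subseq xs w \<or> (\<exists>ys. xs = ys @ [x] \<and> subseq ys w)"
proof
  assume "subseq xs (w @ [x])"
  then obtain us vs where "xs = us @ vs" "subseq us w" "subseq vs [x]"
    by (auto simp: subseq_append_iff)
  then show "subseq xs w \<or> (\<exists>ys. xs = ys @ [x] \<and> subseq ys w)"
    by (cases vs) (auto split: if_splits)
qed (auto intro: list_emb_append_mono)

text \<open>Insertion into a single row that is kept as a set, with the bumped numbers collected in
  a word. Forgetting the order is harmless, since \<open>schensted_insert\<close> consults a row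
  only through the set of its entries.\<close>

definition bump_step :: "nat \<Rightarrow> nat set \<times> nat list \<Rightarrow> nat set \<times> nat list" where
  "bump_step x = (\<lambda>(R, b). if \<exists>y\<in>R. x < y
     then let y = Min {y \<in> R. x < y} in (insert x (R - {y}), b @ [y])
     else (insert x R, b))"

text \<open>
  \<open>row_set w\<close> is the bottom row of the insertion tableau of \<open>w\<close>, and \<open>bumped w\<close> is the word of
  the numbers bumped out of that row, in the order in which they are inserted into the second row.
\<close>

definition row_set :: "nat list \<Rightarrow> nat set" where
  "row_set w = fst (fold bump_step w ({}, []))"

definition bumped :: "nat list \<Rightarrow> nat list" where
  "bumped w = snd (fold bump_step w ({}, []))"

definition tab :: "nat list \<Rightarrow> tableau" where
  "tab w = fold (\<lambda>x T. fst (schensted_insert x T)) w []"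

lemma row_set_Nil [simp]: "row_set [] = {}"
  and bumped_Nil [simp]: "bumped [] = []"
  and tab_Nil [simp]: "tab [] = []"
  by (simp_all add: row_set_def bumped_def tab_def)

lemma tab_snoc: "tab (w @ [x]) = fst (schensted_insert x (tab w))"
  by (simp add: tab_def)

lemma snoc_no_bump:
  assumes "\<forall>y\<in>row_set w. \<not> x < y"
  shows "row_set (w @ [x]) = insert x (row_set w)" and "bumped (w @ [x]) = bumped w"
  using assms by (auto simp: row_set_def bumped_def bump_step_def split: prod.splits)

lemma snoc_bump:
  assumes "\<exists>y\<in>row_set w. x < y"
  shows "row_set (w @ [x]) = insert x (row_set w - {Min {y \<in> row_set w. x < y}})"
    and "bumped (w @ [x]) = bumped w @ [Min {y \<in> row_set w. x < y}]"
  using assms by (auto simp: row_set_def bumped_def bump_step_def Let_def split: prod.splits)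

lemma finite_row_set [simp]: "finite (row_set w)"
proof (induction w rule: rev_induct)
  case (snoc x w)
  then show ?case
    by (cases "\<exists>y\<in>row_set w. x < y") (simp_all add: snoc_bump snoc_no_bump)
qed simp

lemma Min_above:
  fixes R :: "nat set"
  assumes "finite R" "\<exists>y\<in>R. x < y"
  shows "Min {y \<in> R. x < y} \<in> R" "x < Min {y \<in> R. x < y}"
    "\<And>y. y \<in> R \<Longrightarrow> y < Min {y \<in> R. x < y} \<Longrightarrow> y \<le> x"
    "\<And>y. y \<in> R \<Longrightarrow> x < y \<Longrightarrow> Min {y \<in> R. x < y} \<le> y"
proof -
  let ?S = "{y \<in> R. x < y}"
  have S: "finite ?S" "?S \<noteq> {}" using assms by auto
  have "Min ?S \<in> ?S" by (rule Min_in[OF S])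
  then show "Min ?S \<in> R" "x < Min ?S" by auto
  show le: "\<And>y. y \<in> R \<Longrightarrow> x < y \<Longrightarrow> Min ?S \<le> y"
    using S by (intro Min_le) auto
  show "\<And>y. y \<in> R \<Longrightarrow> y < Min ?S \<Longrightarrow> y \<le> x"
    using le by (meson leD not_le_imp_less)
qed

text \<open>The bumped \<open>y\<close> is the least row element above \<open>x\<close>. What the
  inductions below use is the resulting gap: no row element lies strictly between \<open>x\<close>
  and \<open>y\<close>.\<close>

lemma snoc_cases [case_names no_bump bump]:
  assumes "\<lbrakk>\<forall>y\<in>row_set w. y \<le> x; row_set (w @ [x]) = insert x (row_set w);
      bumped (w @ [x]) = bumped w\<rbrakk> \<Longrightarrow> thesis"
    and "\<And>y. \<lbrakk>y \<in> row_set w; x < y; \<And>r. r \<in> row_set w \<Longrightarrow> r < y \<Longrightarrow> r \<le> x;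
      y = Min {y \<in> row_set w. x < y};
      row_set (w @ [x]) = insert x (row_set w - {y}); bumped (w @ [x]) = bumped w @ [y]\<rbrakk> \<Longrightarrow> thesis"
  shows thesis
proof (cases "\<exists>y\<in>row_set w. x < y")
  case True
  note m = Min_above[OF finite_row_set True]
  show thesis
    by (rule assms(2)[of "Min {y \<in> row_set w. x < y}"]) (use m snoc_bump[OF True] in auto)
next
  case False
  then show thesis by (intro assms(1)) (auto simp: snoc_no_bump not_less)
qed

text \<open>For the last claim: a letter is displaced by a smaller one, and if that witness is
  bumped later, its own replacement is smaller still.\<close>

lemma row_set_bumped:
  assumes "distinct w"
  shows "set w = row_set w \<union> set (bumped w)" "row_set w \<inter> set (bumped w) = {}"
    "distinct (bumped w)" "length (bumped w) + card (row_set w) = length w"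
    "\<forall>b\<in>set (bumped w). \<exists>r\<in>row_set w. r < b"
proof -
  have "set w = row_set w \<union> set (bumped w) \<and> row_set w \<inter> set (bumped w) = {} \<and>
    distinct (bumped w) \<and> length (bumped w) + card (row_set w) = length w \<and>
    (\<forall>b\<in>set (bumped w). \<exists>r\<in>row_set w. r < b)"
    using assms
  proof (induction w rule: rev_induct)
    case (snoc x w)
    then have IH: "set w = row_set w \<union> set (bumped w)" "row_set w \<inter> set (bumped w) = {}"
      "distinct (bumped w)" "length (bumped w) + card (row_set w) = length w"
      "\<forall>b\<in>set (bumped w). \<exists>r\<in>row_set w. r < b" and x: "x \<notin> set w"
      by auto
    show ?case
    proof (cases rule: snoc_cases[of w x])
      case no_bump
      then show ?thesis using IH x by auto
    next
      case (bump y)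
      have "\<exists>r\<in>insert x (row_set w - {y}). r < b" if b: "b \<in> set (bumped w)" for b
      proof -
        obtain r where "r \<in> row_set w" "r < b" using IH(5) b by blast
        then show ?thesis using bump(2) by (cases "r = y") auto
      qed
      moreover have "card (insert x (row_set w - {y})) = card (row_set w)"
        using x IH(1) by (subst card.remove[OF finite_row_set bump(1)]) simp
      moreover have "set (w @ [x]) = insert x (row_set w - {y}) \<union> set (bumped w @ [y])"
        using IH(1) bump(1) by auto
      moreover have "insert x (row_set w - {y}) \<inter> set (bumped w @ [y]) = {}"
        using IH(1,2) bump(1,2) x by auto
      moreover have "distinct (bumped w @ [y])"
        using IH(2,3) bump(1) by auto
      moreover have "length (bumped w @ [y]) + card (row_set w) = length (w @ [x])"
        using IH(4) by simp
      moreover have "\<exists>r\<in>insert x (row_set w - {y}). r < y" using bump(2) by blast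
      ultimately show ?thesis unfolding bump(5,6) by simp
    qed
  qed simp
  then show "set w = row_set w \<union> set (bumped w)" "row_set w \<inter> set (bumped w) = {}"
    "distinct (bumped w)" "length (bumped w) + card (row_set w) = length w"
    "\<forall>b\<in>set (bumped w). \<exists>r\<in>row_set w. r < b" by auto
qed

lemma row_set_nonempty: "w \<noteq> [] \<Longrightarrow> row_set w \<noteq> {}"
proof (cases w rule: rev_cases)
  case (snoc u x)
  then show ?thesis by (cases rule: snoc_cases[of u x]) auto
qed simp

lemma length_bumped_less:
  assumes "distinct w" "w \<noteq> []"
  shows "length (bumped w) < length w"
  using row_set_bumped(4)[OF assms(1)] row_set_nonempty[OF assms(2)]
  by (metis add_lessD1 card_gt_0_iff finite_row_set less_add_same_cancel1)

lemma Min_row_set: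
  assumes "distinct w" "w \<noteq> []"
  shows "Min (row_set w) = Min (set w)"
proof (rule Min_eqI[symmetric])
  show "Min (row_set w) \<in> set w"
    using row_set_bumped(1)[OF assms(1)] Min_in[OF finite_row_set row_set_nonempty[OF assms(2)]] by auto
  fix y assume "y \<in> set w"
  then obtain r where "r \<in> row_set w" "r \<le> y"
    using row_set_bumped(1,5)[OF assms(1)] by (metis UnE less_imp_le_nat order_refl)
  then show "Min (row_set w) \<le> y" by (meson Min_le finite_row_set le_trans)
qed simp

text \<open>This is induction on the rows of the tableau: passing from \<open>w\<close> to
  \<open>bumped w\<close> removes the bottom row.\<close>

lemma distinct_bumped_induct [consumes 1, case_names Nil bumped]:
  fixes w :: "nat list"
  assumes "distinct w" "P []" "\<And>w. distinct w \<Longrightarrow> w \<noteq> [] \<Longrightarrow> P (bumped w) \<Longrightarrow> P w"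
  shows "P w"
  using assms(1)
proof (induction w rule: length_induct)
  case (1 w)
  then show ?case using assms(2,3)
    by (cases "w = []") (auto simp: length_bumped_less row_set_bumped(3))
qed

text \<open>Numbers leaving the bottom row enter the second row in the order of bumping, so the
  upper rows form the tableau of \<open>bumped w\<close>. Of the order within the bottom row the
  induction tracks only that its head is minimal, which is what the first column depends on.\<close>

lemma tab_bumped:
  assumes "distinct w" "w \<noteq> []"
  obtains r where "tab w = r # tab (bumped w)" "r \<noteq> []" "set r = row_set w" "r ! 0 = Min (set w)"
proof -
  have "\<exists>r. tab w = r # tab (bumped w) \<and> r \<noteq> [] \<and> set r = row_set w \<and> (\<forall>y\<in>set r. r ! 0 \<le> y)"
    using assms
  proof (induction w rule: rev_induct)
    case (snoc x w)
    show ?case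
    proof (cases "w = []")
      case True
      then show ?thesis by (simp add: tab_def row_set_def bumped_def bump_step_def)
    next
      case False
      with snoc obtain r where r: "tab w = r # tab (bumped w)" "r \<noteq> []" "set r = row_set w"
        "\<forall>y\<in>set r. r ! 0 \<le> y" by auto
      have x: "x \<notin> row_set w" using snoc.prems row_set_bumped(1)[of w] by auto
      have r0: "r ! 0 \<in> set r" using r(2) by simp
      show ?thesis
      proof (cases rule: snoc_cases[of w x])
        case no_bump
        then have "\<forall>y\<in>row_set w. y < x" using x le_neq_implies_less by blast
        then show ?thesis using r no_bump r0 by (auto simp: tab_snoc nth_append)
      next
        case (bump y)
        let ?f = "\<lambda>e. if e = y then x else e"
        have eq: "tab (w @ [x]) = map ?f r # tab (bumped w @ [y])"
        proof -
          have "\<not> (\<forall>z\<in>set r. z < x)" using bump(1,2) r(3) by (metis order.asym)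
          moreover have "Min {z \<in> set r. x < z} = y" using bump(4) r(3) by simp
          ultimately show ?thesis
            unfolding tab_snoc r(1) by (simp add: Let_def split: prod.splits)
        qed
        have "set (map ?f r) = insert x (row_set w - {y})"
          using bump(1) r(3) by auto
        moreover have "map ?f r ! 0 = ?f (r ! 0)" using r(2) by (cases r) auto
        moreover have "?f (r ! 0) \<le> e" if "e \<in> insert x (row_set w - {y})" for e
        proof (cases "r ! 0 = y")
          case True
          then show ?thesis using r(3,4) that bump(2) by force
        next
          case False
          then have "r ! 0 < y" using r(3,4) bump(1) by force
          then show ?thesis using False bump(3)[of "r ! 0"] r r0 that by auto
        qed
        ultimately show ?thesis using eq bump(5,6) r(2) by simp
      qed
    qed
  qed simp
  then obtain r where r: "tab w = r # tab (bumped w)" "r \<noteq> []" "set r = row_set w"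
    "\<forall>y\<in>set r. r ! 0 \<le> y" by auto
  have "r ! 0 = Min (set r)" using r(2,4) by (intro Min_eqI[symmetric]) auto
  then show ?thesis using that[of r] r Min_row_set[OF assms] by simp
qed

section \<open>Schensted's theorem on longest decreasing subsequences\<close>

definition has_dec :: "nat \<Rightarrow> nat list \<Rightarrow> bool" where
  "has_dec k w \<longleftrightarrow> (\<exists>xs. subseq xs w \<and> sorted_wrt (>) xs \<and> length xs = k)"

text \<open>
  The second claim is the invariant that makes the induction over \<open>w\<close> work: an element \<open>r\<close> of the
  bottom row below \<open>ys\<close> was either inserted after the last element of \<open>ys\<close> was bumped, or lies
  weakly below the number which bumped it.
\<close>

lemma dec_from_bumped:
  assumes "distinct w" "subseq ys (bumped w)" "sorted_wrt (>) ys"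
  shows "\<forall>y\<in>set ys. v < y \<Longrightarrow>
      \<exists>us. subseq us w \<and> sorted_wrt (>) us \<and> length us = length ys \<and> (\<forall>u\<in>set us. v < u)"
    and "r \<in> row_set w \<Longrightarrow> \<forall>y\<in>set ys. r < y \<Longrightarrow>
      \<exists>us. subseq us w \<and> sorted_wrt (>) us \<and> length us = Suc (length ys) \<and> (\<forall>u\<in>set us. r \<le> u)"
proof -
  have "((\<forall>y\<in>set ys. v < y) \<longrightarrow>
      (\<exists>us. subseq us w \<and> sorted_wrt (>) us \<and> length us = length ys \<and> (\<forall>u\<in>set us. v < u))) \<and>
    (r \<in> row_set w \<longrightarrow> (\<forall>y\<in>set ys. r < y) \<longrightarrow>
      (\<exists>us. subseq us w \<and> sorted_wrt (>) us \<and> length us = Suc (length ys) \<and> (\<forall>u\<in>set us. r \<le> u)))"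
    using assms
  proof (induction w arbitrary: ys v r rule: rev_induct)
    case Nil
    then show ?case by auto
  next
    case (snoc x w)
    have dw: "distinct w" "x \<notin> set w" using snoc.prems by auto
    have IHv: "\<exists>us. subseq us (w @ [x]) \<and> sorted_wrt (>) us \<and> length us = length ys \<and> (\<forall>u\<in>set us. v < u)"
      if "subseq ys (bumped w)" "sorted_wrt (>) ys" "\<forall>y\<in>set ys. v < y" for ys v
      using snoc.IH[OF dw(1) that(1,2)] that(3) by (metis subseq_snoc_iff)
    have IHr: "\<exists>us. subseq us w \<and> sorted_wrt (>) us \<and> length us = Suc (length ys) \<and> (\<forall>u\<in>set us. r \<le> u)"
      if "subseq ys (bumped w)" "sorted_wrt (>) ys" "r \<in> row_set w" "\<forall>y\<in>set ys. r < y" for ys r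
      using snoc.IH[OF dw(1) that(1,2)] that(3,4) by blast
    have IHr': "\<exists>us. subseq us (w @ [x]) \<and> sorted_wrt (>) us \<and> length us = Suc (length ys) \<and> (\<forall>u\<in>set us. r \<le> u)"
      if "subseq ys (bumped w)" "sorted_wrt (>) ys" "r \<in> row_set w" "\<forall>y\<in>set ys. r < y" for ys r
      using IHr[OF that] by (metis subseq_snoc_iff)
    \<comment> \<open>Here the row element is the new letter \<open>x\<close>: the first claim with
      \<open>v = x\<close> yields letters above \<open>x\<close>, and \<open>x\<close> can be
      appended.\<close>
    have IHx: "\<exists>us. subseq us (w @ [x]) \<and> sorted_wrt (>) us \<and> length us = Suc (length ys) \<and> (\<forall>u\<in>set us. x \<le> u)"
      if ys: "subseq ys (bumped w)" "sorted_wrt (>) ys" "\<forall>y\<in>set ys. x < y" for ys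
    proof -
      obtain us where "subseq us w" "sorted_wrt (>) us" "length us = length ys" "\<forall>u\<in>set us. x < u"
        using snoc.IH[OF dw(1) ys(1,2)] ys(3) by blast
      then show ?thesis
        by (intro exI[of _ "us @ [x]"]) (auto simp: sorted_wrt_append)
    qed
    show ?case
    proof (cases rule: snoc_cases[of w x])
      case no_bump
      then show ?thesis
        using snoc.prems(2,3) IHv[of ys v] IHr'[of ys r] IHx[of ys] unfolding no_bump(2,3)
        by (metis insert_iff)
    next
      case (bump y)
      consider "subseq ys (bumped w)" | zs where "ys = zs @ [y]" "subseq zs (bumped w)"
        using snoc.prems(2) by (auto simp: bump(6) subseq_snoc_iff)
      then show ?thesis
      proof cases
        case 1
        then show ?thesis
          using IHv[OF 1 snoc.prems(3), of v] IHr'[OF 1 snoc.prems(3), of r] IHx[OF 1 snoc.prems(3)]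
          unfolding bump(5) by (metis Diff_iff insert_iff)
      next
        case 2
        have zs: "sorted_wrt (>) zs" "\<forall>z\<in>set zs. y < z"
          using snoc.prems(3) by (auto simp: 2(1) sorted_wrt_append)
        \<comment> \<open>The invariant for \<open>zs\<close> and the row element \<open>y\<close>,
          taken just before \<open>y\<close> is bumped, already produces a sequence as long as
          \<open>ys\<close>.\<close>
        obtain us where us: "subseq us w" "sorted_wrt (>) us" "length us = Suc (length zs)"
          "\<forall>u\<in>set us. y \<le> u"
          using IHr[OF 2(2) zs(1) bump(1) zs(2)] by blast
        have "\<exists>us. subseq us (w @ [x]) \<and> sorted_wrt (>) us \<and> length us = length ys \<and> (\<forall>u\<in>set us. v < u)"
          if "\<forall>y\<in>set ys. v < y"
          using us that by (intro exI[of _ us]) (auto simp: 2(1))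
        moreover have "\<exists>us. subseq us (w @ [x]) \<and> sorted_wrt (>) us \<and> length us = Suc (length ys) \<and> (\<forall>u\<in>set us. r \<le> u)"
          if "r \<in> row_set (w @ [x])" "\<forall>y\<in>set ys. r < y"
        proof -
          \<comment> \<open>Since \<open>y\<close> belongs to \<open>ys\<close>, \<open>r\<close> is
            below \<open>y\<close>, and the row has nothing strictly between \<open>x\<close> and
            \<open>y\<close>. So \<open>x\<close>, which lies below all of \<open>us\<close>, may be
            appended.\<close>
          have "r \<le> x" using that bump(3) by (auto simp: bump(5) 2(1))
          then show ?thesis using us bump(2)
            by (intro exI[of _ "us @ [x]"]) (force simp: sorted_wrt_append 2(1))
        qed
        ultimately show ?thesis by blast
      qed
    qed
  qed
  then show "\<forall>y\<in>set ys. v < y \<Longrightarrow>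
      \<exists>us. subseq us w \<and> sorted_wrt (>) us \<and> length us = length ys \<and> (\<forall>u\<in>set us. v < u)"
    and "r \<in> row_set w \<Longrightarrow> \<forall>y\<in>set ys. r < y \<Longrightarrow>
      \<exists>us. subseq us w \<and> sorted_wrt (>) us \<and> length us = Suc (length ys) \<and> (\<forall>u\<in>set us. r \<le> u)"
    by blast+
qed

text \<open>
  Between the insertions of two consecutive elements \<open>a > b\<close> of a decreasing subsequence some number
  in \<open>{b<..a}\<close> is bumped out of the bottom row: either \<open>a\<close> itself or the number bumped by \<open>b\<close>.
\<close>

lemma dec_to_bumped:
  assumes "distinct w" "subseq (xs @ [x]) w" "sorted_wrt (>) (xs @ [x])"
  shows "(\<exists>ys. subseq ys (bumped w) \<and> sorted_wrt (>) ys \<and> length ys = length xs \<and> (\<forall>y\<in>set ys. x < y)) \<and>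
    (x \<in> row_set w \<or>
     (\<exists>ys. subseq ys (bumped w) \<and> sorted_wrt (>) ys \<and> length ys = Suc (length xs) \<and> (\<forall>y\<in>set ys. x \<le> y)))"
  using assms
proof (induction w arbitrary: xs x rule: rev_induct)
  case (snoc a w)
  have dw: "distinct w" using snoc.prems by auto
  \<comment> \<open>The weak bound lets one predicate serve both claims; the strict bound is
    obtained with \<open>Suc x\<close> in place of \<open>x\<close>.\<close>
  define D where "D = (\<lambda>k v b. \<exists>ys. subseq ys b \<and> sorted_wrt (>) ys \<and> length ys = k \<and> (\<forall>y\<in>set ys. (v::nat) \<le> y))"
  have D_app: "D (Suc k) v (b @ [y])" if D: "D k v' b" "v \<le> y" "y < v'" for k v v' b y
  proof -
    obtain ys where "subseq ys b" "sorted_wrt (>) ys" "length ys = k" "\<forall>z\<in>set ys. v' \<le> z"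
      using D(1) unfolding D_def by blast
    then show ?thesis unfolding D_def using D(2,3)
      by (intro exI[of _ "ys @ [y]"]) (force simp: sorted_wrt_append)
  qed
  have D_mono: "D k v' b'" if D: "D k v b" "v' \<le> v" "subseq b b'" for k v v' b b'
  proof -
    obtain ys where "subseq ys b" "sorted_wrt (>) ys" "length ys = k" "\<forall>z\<in>set ys. v \<le> z"
      using D(1) unfolding D_def by blast
    then show ?thesis unfolding D_def using D(2,3)
      by (intro exI[of _ ys]) (auto intro: subseq_order.order_trans)
  qed
  have sub: "subseq (bumped w) (bumped (w @ [a]))"
    by (cases rule: snoc_cases[of w a]) auto
  have IH: "D (length xs) (Suc x) (bumped w)" "x \<in> row_set w \<or> D (Suc (length xs)) x (bumped w)"
    if "subseq (xs @ [x]) w" "sorted_wrt (>) (xs @ [x])" for xs x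
    using snoc.IH[OF dw that] by (auto simp: D_def Suc_le_eq)
  consider "subseq (xs @ [x]) w" | "x = a" "subseq xs w"
    using snoc.prems(2) by (auto simp: subseq_snoc_iff)
  then have "D (length xs) (Suc x) (bumped (w @ [a])) \<and>
    (x \<in> row_set (w @ [a]) \<or> D (Suc (length xs)) x (bumped (w @ [a])))"
  proof cases
    case 1
    note IH' = IH[OF 1 snoc.prems(3)]
    show ?thesis
    proof (cases "x \<in> row_set w \<and> x \<notin> row_set (w @ [a])")
      case True
      then show ?thesis
      proof (cases rule: snoc_cases[of w a])
        case (bump y)
        with True have "x = y" by auto
        then show ?thesis using IH'(1) bump(6) D_app[OF IH'(1), of x x] D_mono[OF IH'(1) _ sub] by auto
      qed auto
    next
      case False
      then show ?thesis using IH' D_mono[OF IH'(1) _ sub] D_mono[OF _ _ sub] by blast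
    qed
  next
    case 2
    have x: "x \<in> row_set (w @ [a])" using 2 by (cases rule: snoc_cases[of w a]) auto
    show ?thesis
    proof (cases xs rule: rev_cases)
      case Nil
      then show ?thesis using x by (auto simp: D_def)
    next
      case (snoc zs z)
      have z: "sorted_wrt (>) (zs @ [z])" "a < z" using snoc.prems(3) 2(1) snoc by (auto simp: sorted_wrt_append)
      note IHz = IH[OF 2(2)[unfolded snoc] z(1)]
      from IHz(2) show ?thesis
      proof
        assume zr: "z \<in> row_set w"
        show ?thesis
        proof (cases rule: snoc_cases[of w a])
          case no_bump
          then show ?thesis using zr z(2) by auto
        next
          case (bump y)
          \<comment> \<open>\<open>z\<close> is itself a row element above \<open>a\<close>, so the
            number \<open>y\<close> bumped by \<open>a\<close> is at most \<open>z\<close> and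
            extends the sequence of letters above \<open>z\<close>.\<close>
          have "y \<le> z" using zr z(2) bump(4) by (intro ord_eq_le_trans[OF bump(4)] Min_le) auto
          then show ?thesis using x D_app[OF IHz(1), of "Suc x" y] bump(2,6) 2(1) snoc by auto
        qed
      next
        assume "D (Suc (length zs)) z (bumped w)"
        then show ?thesis using x z(2) 2(1) snoc D_mono[OF _ _ sub] by (metis Suc_leI length_append_singleton)
      qed
    qed
  qed
  then show ?case by (auto simp: D_def Suc_le_eq)
qed simp

text \<open>Removing the bottom row costs exactly one letter. For the converse direction the row
  element is the minimum of the row, which lies below every bumped letter.\<close>

lemma has_dec_bumped:
  assumes "distinct w" "w \<noteq> []"
  shows "has_dec (Suc k) w \<longleftrightarrow> has_dec k (bumped w)"
proof
  assume "has_dec (Suc k) w"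
  then obtain zs where zs: "subseq zs w" "sorted_wrt (>) zs" "length zs = Suc k" by (auto simp: has_dec_def)
  then obtain xs x where "zs = xs @ [x]" by (cases zs rule: rev_cases) auto
  with zs show "has_dec k (bumped w)"
    using dec_to_bumped[OF assms(1), of xs x] by (auto simp: has_dec_def)
next
  assume "has_dec k (bumped w)"
  then obtain ys where ys: "subseq ys (bumped w)" "sorted_wrt (>) ys" "length ys = k" by (auto simp: has_dec_def)
  let ?m = "Min (row_set w)"
  have m: "?m \<in> row_set w" using row_set_nonempty[OF assms(2)] by simp
  have "?m < y" if "y \<in> set ys" for y
  proof -
    have "y \<in> set (bumped w)" using that ys(1) by (metis in_mono set_nths_subset subseq_conv_nths)
    then obtain r where "r \<in> row_set w" "r < y" using row_set_bumped(5)[OF assms(1)] by blast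
    then show ?thesis by (meson Min_le finite_row_set le_less_trans)
  qed
  then show "has_dec (Suc k) w"
    using dec_from_bumped(2)[OF assms(1) ys(1,2) m] ys(3) by (auto simp: has_dec_def)
qed

text \<open>Stripping off bottom rows one at a time shortens the longest decreasing subsequence by
  one each time. An equivalence for every \<open>k\<close> takes the place of a maximum over
  subsequences.\<close>

theorem schensted_rows:
  assumes "distinct w"
  shows "has_dec k w \<longleftrightarrow> k \<le> length (tab w)"
  using assms
proof (induction w arbitrary: k rule: distinct_bumped_induct)
  case Nil
  then show ?case by (auto simp: has_dec_def)
next
  case (bumped w)
  obtain r where r: "tab w = r # tab (bumped w)" using tab_bumped[OF bumped(1,2)] .
  show ?case
  proof (cases k)
    case 0
    then show ?thesis by (auto simp: has_dec_def intro: exI[of _ "[]"])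
  next
    case (Suc k')
    then show ?thesis using bumped(3)[of k'] has_dec_bumped[OF bumped(1,2), of k'] r by simp
  qed
qed

section \<open>The first column of the insertion tableau and restriction to small letters\<close>

lemma column_tab_bumped:
  assumes "distinct w" "w \<noteq> []"
  shows "column (tab w) 0 = Min (set w) # column (tab (bumped w)) 0"
proof -
  obtain r where "tab w = r # tab (bumped w)" "r \<noteq> []" "r ! 0 = Min (set w)"
    using tab_bumped[OF assms] .
  then show ?thesis by (simp add: column_def)
qed

lemma snoc_bump_eq:
  assumes "y \<in> row_set w" "x < y" "\<And>r. r \<in> row_set w \<Longrightarrow> r < y \<Longrightarrow> r \<le> x"
  shows "row_set (w @ [x]) = insert x (row_set w - {y})" "bumped (w @ [x]) = bumped w @ [y]"
proof -
  have "Min {y \<in> row_set w. x < y} = y"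
    using assms by (intro Min_eqI) (auto simp: not_less[symmetric])
  then show "row_set (w @ [x]) = insert x (row_set w - {y})" "bumped (w @ [x]) = bumped w @ [y]"
    using snoc_bump[of w x] assms by auto
qed

text \<open>Letters above \<open>v\<close> never influence those up to \<open>v\<close>: if a small
  \<open>x\<close> bumps some \<open>y\<close> above \<open>v\<close>, then \<open>x\<close> exceeds
  or equals every small row element and is simply added to the restricted row.\<close>

lemma filter_le_bumped:
  "row_set (filter (\<lambda>x. x \<le> v) w) = {r \<in> row_set w. r \<le> v} \<and>
   bumped (filter (\<lambda>x. x \<le> v) w) = filter (\<lambda>x. x \<le> v) (bumped w)"
proof (induction w rule: rev_induct)
  case (snoc x w)
  let ?f = "filter (\<lambda>x. x \<le> v)"
  have IH: "row_set (?f w) = {r \<in> row_set w. r \<le> v}" "bumped (?f w) = ?f (bumped w)"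
    using snoc by auto
  show ?case
  proof (cases rule: snoc_cases[of w x])
    case no_bump
    then have "\<forall>y\<in>row_set (?f w). \<not> x < y" by (auto simp: IH)
    then show ?thesis using no_bump IH snoc_no_bump[of "?f w" x] by auto
  next
    case (bump y)
    consider "x \<le> v" "y \<le> v" | "x \<le> v" "v < y" | "v < x" by linarith
    then show ?thesis
    proof cases
      case 1
      have "row_set (?f w @ [x]) = insert x (row_set (?f w) - {y})" "bumped (?f w @ [x]) = bumped (?f w) @ [y]"
        by (rule snoc_bump_eq[of y]; use bump(1,2,3) 1 in \<open>simp add: IH\<close>)+
      then show ?thesis using 1 IH bump(5,6) by auto
    next
      case 2
      have "\<forall>z\<in>row_set (?f w). \<not> x < z"
        using 2 bump(3) by (auto simp: IH not_less)
      then show ?thesis using 2 bump(5,6) IH snoc_no_bump[of "?f w" x] by auto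
    next
      case 3
      then show ?thesis using bump(2,5,6) IH by auto
    qed
  qed
qed simp

lemma column_tab:
  assumes "distinct w"
  shows "distinct (column (tab w) 0)" "set (column (tab w) 0) \<subseteq> set w"
proof -
  have "distinct (column (tab w) 0) \<and> set (column (tab w) 0) \<subseteq> set w"
    using assms
  proof (induction w rule: distinct_bumped_induct)
    case (bumped w)
    have "Min (set w) \<in> row_set w"
      using Min_in[OF finite_row_set row_set_nonempty[OF bumped(2)]] Min_row_set[OF bumped(1,2)] by simp
    then show ?case
      using bumped(3) row_set_bumped(1,2)[OF bumped(1)] column_tab_bumped[OF bumped(1,2)] by auto
  qed (simp add: column_def)
  then show "distinct (column (tab w) 0)" "set (column (tab w) 0) \<subseteq> set w" by auto
qed

text \<open>The least letter heads the column, and it is at most \<open>v\<close> exactly when the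
  restricted word is nonempty. Restriction commutes with bumping, so the count proceeds row by
  row.\<close>

lemma card_column_tab:
  assumes "distinct w"
  shows "card {h \<in> set (column (tab w) 0). h \<le> v} = length (tab (filter (\<lambda>x. x \<le> v) w))"
  using assms
proof (induction w rule: distinct_bumped_induct)
  case Nil
  then show ?case by (simp add: column_def)
next
  case (bumped w)
  let ?f = "filter (\<lambda>x. x \<le> v)"
  note col = column_tab_bumped[OF bumped(1,2)]
  have m: "Min (set w) \<in> set w" using bumped(2) by simp
  show ?case
  proof (cases "?f w = []")
    case True
    have "h > v" if "h \<in> set (column (tab w) 0)" for h
      using that column_tab(2)[OF bumped(1)] True by (auto simp: filter_empty_conv not_le)
    then have "{h \<in> set (column (tab w) 0). h \<le> v} = {}" by force
    then show ?thesis using True by simp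
  next
    case False
    then obtain e where e: "e \<in> set w" "e \<le> v" by (auto simp: filter_empty_conv)
    then have mv: "Min (set w) \<le> v" by (meson List.finite_set Min_le le_trans)
    have d: "Min (set w) \<notin> set (column (tab (bumped w)) 0)"
      using column_tab(1)[OF bumped(1)] col by simp
    have "{h \<in> set (column (tab w) 0). h \<le> v} =
        insert (Min (set w)) {h \<in> set (column (tab (bumped w)) 0). h \<le> v}"
      using col mv by auto
    then have "card {h \<in> set (column (tab w) 0). h \<le> v} = Suc (length (tab (?f (bumped w))))"
      using d bumped(3) by simp
    moreover obtain r where "tab (?f w) = r # tab (bumped (?f w))"
      using tab_bumped[of "?f w"] False bumped(1) by auto
    ultimately show ?thesis using filter_le_bumped by simp
  qed
qed

section \<open>The first column of the recording tableau\<close>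

lemma schensted_insert_position:
  "schensted_insert x T = (T', k) \<Longrightarrow>
     k \<le> length T \<and> length T' = (if k < length T then length T else Suc (length T))"
  by (induction x T arbitrary: T' k rule: schensted_insert.induct)
     (auto simp: Let_def split: if_splits prod.splits)

lemma rsk_Nil: "rsk [] = ([], [])"
  by (simp add: rsk_def)

lemma rsk_snoc: "rsk (w @ [x]) = rsk_step (Suc (length w), x) (rsk w)"
proof -
  have "[1..<Suc (length (w @ [x]))] = [1..<Suc (length w)] @ [Suc (length w)]" by simp
  then show ?thesis by (simp add: rsk_def del: upt_Suc)
qed

lemma fst_rsk: "fst (rsk w) = tab w"
proof (induction w rule: rev_induct)
  case (snoc x w)
  then show ?case by (cases "rsk w") (simp add: rsk_snoc tab_snoc split: prod.splits)
qed (simp add: rsk_Nil)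

lemma snd_rsk_snoc:
  "snd (rsk (w @ [x])) = add_box (snd (schensted_insert x (tab w))) (Suc (length w)) (snd (rsk w))"
  by (cases "rsk w") (simp add: rsk_snoc fst_rsk[symmetric] split: prod.splits)

lemma column_nonempty_rows:
  "\<forall>r\<in>set T. r \<noteq> [] \<Longrightarrow> column T 0 = map (\<lambda>r. r ! 0) T"
  by (simp add: column_def)

text \<open>Step \<open>m\<close> puts its label into the first column exactly when it opens a new
  row, so the labels up to \<open>i\<close> count the rows present after \<open>i\<close>
  steps.\<close>

lemma snd_rsk:
  "length (snd (rsk w)) = length (tab w)" "\<forall>r\<in>set (snd (rsk w)). r \<noteq> []"
  "distinct (column (snd (rsk w)) 0)" "set (column (snd (rsk w)) 0) \<subseteq> {1..length w}"
  "i \<le> length w \<Longrightarrow> card {h \<in> set (column (snd (rsk w)) 0). h \<le> i} = length (tab (take i w))"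
proof -
  have "length (snd (rsk w)) = length (tab w) \<and> (\<forall>r\<in>set (snd (rsk w)). r \<noteq> []) \<and>
    distinct (column (snd (rsk w)) 0) \<and> set (column (snd (rsk w)) 0) \<subseteq> {1..length w} \<and>
    (\<forall>i\<le>length w. card {h \<in> set (column (snd (rsk w)) 0). h \<le> i} = length (tab (take i w)))"
  proof (induction w rule: rev_induct)
    case Nil
    then show ?case by (simp add: rsk_Nil column_def)
  next
    case (snoc x w)
    let ?Q = "snd (rsk w)" and ?Q' = "snd (rsk (w @ [x]))" and ?m = "Suc (length w)"
    obtain T' k where ins: "schensted_insert x (tab w) = (T', k)" by fastforce
    have k: "k \<le> length (tab w)" "length T' = (if k < length (tab w) then length (tab w) else Suc (length (tab w)))"
      using schensted_insert_position[OF ins] by auto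
    have T': "tab (w @ [x]) = T'" by (simp add: tab_snoc ins)
    have IH: "length ?Q = length (tab w)" "\<forall>r\<in>set ?Q. r \<noteq> []"
      "distinct (column ?Q 0)" "set (column ?Q 0) \<subseteq> {1..length w}"
      "\<And>i. i \<le> length w \<Longrightarrow> card {h \<in> set (column ?Q 0). h \<le> i} = length (tab (take i w))"
      using snoc by auto
    have Q': "?Q' = add_box k ?m ?Q" by (simp add: snd_rsk_snoc ins)
    have len: "length ?Q' = length (tab (w @ [x]))"
      using k IH(1) by (simp add: Q' T' add_box_def)
    have rows: "\<forall>r\<in>set ?Q'. r \<noteq> []"
      using IH(2) by (auto simp: Q' add_box_def dest!: set_update_subset_insert[THEN subsetD])
    have col: "column ?Q' 0 = (if k < length (tab w) then column ?Q 0 else column ?Q 0 @ [?m])"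
    proof (cases "k < length (tab w)")
      case True
      then have "?Q ! k \<noteq> []" using IH(1,2) by auto
      then have "map (\<lambda>r. r ! 0) (?Q[k := ?Q ! k @ [?m]]) = map (\<lambda>r. r ! 0) ?Q"
        using True IH(1) by (simp add: map_update nth_append list_update_same_conv)
      then show ?thesis using True IH(1) column_nonempty_rows[OF rows] column_nonempty_rows[OF IH(2)]
        by (simp add: Q' add_box_def)
    next
      case False
      then show ?thesis using IH(1) column_nonempty_rows[OF rows] column_nonempty_rows[OF IH(2)]
        by (simp add: Q' add_box_def)
    qed
    have d: "distinct (column ?Q' 0)" "set (column ?Q' 0) \<subseteq> {1..length (w @ [x])}"
      using IH(3,4) by (auto simp: col subset_iff le_Suc_eq Suc_le_eq)
    have "card {h \<in> set (column ?Q' 0). h \<le> i} = length (tab (take i (w @ [x])))"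
      if i: "i \<le> length (w @ [x])" for i
    proof (cases "i \<le> length w")
      case True
      then have "{h \<in> set (column ?Q' 0). h \<le> i} = {h \<in> set (column ?Q 0). h \<le> i}"
        by (auto simp: col)
      then show ?thesis using True IH(5) by simp
    next
      case False
      then have "{h \<in> set (column ?Q' 0). h \<le> i} = set (column ?Q' 0)"
        using d(2) by force
      then have "card {h \<in> set (column ?Q' 0). h \<le> i} = length ?Q'"
        using distinct_card[OF d(1)] column_nonempty_rows[OF rows] by (metis length_map)
      then show ?thesis using len False i by simp
    qed
    then show ?case using len rows d by blast
  qed
  then show "length (snd (rsk w)) = length (tab w)" "\<forall>r\<in>set (snd (rsk w)). r \<noteq> []"
    "distinct (column (snd (rsk w)) 0)" "set (column (snd (rsk w)) 0) \<subseteq> {1..length w}"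
    "i \<le> length w \<Longrightarrow> card {h \<in> set (column (snd (rsk w)) 0). h \<le> i} = length (tab (take i w))"
    by auto
qed

section \<open>Tightness of the rank inequality\<close>

lemma sum_ranks:
  fixes A :: "'a::linorder set"
  assumes "finite A"
  shows "2 * (\<Sum>a\<in>A. card {b \<in> A. b \<le> a}) = card A * Suc (card A)"
  using assms
proof (induction A rule: finite_linorder_max_induct)
  case (insert m A)
  have "{b \<in> insert m A. b \<le> m} = insert m A" using insert(2) by auto
  moreover have "{b \<in> insert m A. b \<le> a} = {b \<in> A. b \<le> a}" if "a \<in> A" for a
    using insert(2) that by auto
  moreover have "m \<notin> A" using insert(2) by blast
  ultimately show ?case using insert(1,3) by (simp add: algebra_simps)
qed simp

text \<open>
  By maximality, a decreasing subsequence of length \<open>Suc r\<close> of the prefix ends in \<open>w ! i\<close>, and one of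
  length \<open>Suc s\<close> among the values up to \<open>w ! i\<close>
  starts there, so the two can be concatenated.
\<close>

lemma dec_through_records:
  assumes w: "distinct w" "0 \<notin> set w" "i < length w"
    and r: "has_dec (Suc r) (take (Suc i) w)" "\<not> has_dec (Suc r) (take i w)"
    and s: "has_dec (Suc s) (filter (\<lambda>y. y \<le> w ! i) w)" "\<not> has_dec (Suc s) (filter (\<lambda>y. y \<le> w ! i - 1) w)"
  shows "has_dec (Suc (r + s)) w"
proof -
  let ?x = "w ! i"
  have x0: "0 < ?x" using w(2,3) by (metis gr0I nth_mem)
  have w_split: "w = take i w @ ?x # drop (Suc i) w" using w(3) by (rule id_take_nth_drop)
  have xnot: "?x \<notin> set (take i w)" using w(1) w_split by (metis distinct_append disjoint_insert(1) list.set(2))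
  obtain xs where xs: "subseq xs (take i w @ [?x])" "sorted_wrt (>) xs" "length xs = Suc r"
    using r(1) w(3) by (auto simp: has_dec_def take_Suc_conv_app_nth)
  then obtain xs' where xs': "xs = xs' @ [?x]" "subseq xs' (take i w)"
    using r(2) by (auto simp: subseq_snoc_iff has_dec_def)
  obtain ys where ys: "subseq ys (filter (\<lambda>y. y \<le> ?x) w)" "sorted_wrt (>) ys" "length ys = Suc s"
    using s(1) by (auto simp: has_dec_def)
  have ys_le: "\<forall>y\<in>set ys. y \<le> ?x"
  proof
    fix y assume "y \<in> set ys"
    then have "y \<in> set (filter (\<lambda>y. y \<le> ?x) w)" using ys(1) by (metis in_mono set_nths_subset subseq_conv_nths)
    then show "y \<le> ?x" by simp
  qed
  have "?x \<in> set ys"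
  proof (rule ccontr)
    assume "?x \<notin> set ys"
    then have "y \<le> ?x - 1" if "y \<in> set ys" for y
      using ys_le that by (metis Suc_pred' le_eq_less_or_eq less_Suc_eq_le x0)
    then have "filter (\<lambda>y. y \<le> ?x - 1) ys = ys" by (simp add: filter_id_conv)
    then have "subseq ys (filter (\<lambda>y. y \<le> ?x - 1) (filter (\<lambda>y. y \<le> ?x) w))"
      using subseq_filter[OF ys(1), of "\<lambda>y. y \<le> ?x - 1"] by simp
    also have "filter (\<lambda>y. y \<le> ?x - 1) (filter (\<lambda>y. y \<le> ?x) w) = filter (\<lambda>y. y \<le> ?x - 1) w"
      by (auto intro: filter_cong)
    finally show False using s(2) ys(2,3) by (auto simp: has_dec_def)
  qed
  then obtain ys' where ys': "ys = ?x # ys'" using ys_le ys(2) by (cases ys) force+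
  have "subseq (?x # ys') (filter (\<lambda>y. y \<le> ?x) (take i w) @ ?x # filter (\<lambda>y. y \<le> ?x) (drop (Suc i) w))"
    using ys(1) unfolding ys' by (subst (asm) (3) w_split) simp
  then obtain us vs where uv: "?x # ys' = us @ vs" "subseq us (filter (\<lambda>y. y \<le> ?x) (take i w))"
    "subseq vs (?x # filter (\<lambda>y. y \<le> ?x) (drop (Suc i) w))"
    by (auto simp: subseq_append_iff)
  have "us = []"
  proof (rule ccontr)
    assume "us \<noteq> []"
    then have "?x \<in> set us" using uv(1) by (cases us) auto
    then show False using uv(2) xnot by (metis filter_is_subset in_mono set_nths_subset subseq_conv_nths)
  qed
  then have "subseq ys' (filter (\<lambda>y. y \<le> ?x) (drop (Suc i) w))" using uv by auto
  then have "subseq ys' (drop (Suc i) w)" using subseq_filter_left subseq_order.order_trans by blast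
  then have "subseq (xs' @ ?x # ys') (take i w @ ?x # drop (Suc i) w)"
    using xs'(2) by (intro list_emb_append_mono) auto
  moreover have "sorted_wrt (>) (xs' @ ?x # ys')"
    using xs(2) ys(2) by (force simp: xs'(1) ys' sorted_wrt_append)
  moreover have "length (xs' @ ?x # ys') = Suc (r + s)" using xs(3) ys(3) by (simp add: xs'(1) ys')
  ultimately show ?thesis unfolding has_dec_def using w_split by metis
qed

text \<open>Positions in \<open>A\<close> count from 1, hence \<open>w ! (i - 1)\<close>. By
  \<open>schensted_rows\<close>, the two claims together say that the points of height at most
  \<open>v\<close> form a longest decreasing subsequence of the letters up to
  \<open>v\<close>.\<close>

lemma first_columns_decreasing:
  fixes w :: "nat list"
  defines "A \<equiv> set (column (snd (rsk w)) 0)" and "B \<equiv> set (column (tab w) 0)"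
  assumes w: "distinct w" "0 \<notin> set w" and AB: "(\<lambda>i. w ! (i - 1)) ` A = B"
  shows "\<And>i i'. i \<in> A \<Longrightarrow> i' \<in> A \<Longrightarrow> i < i' \<Longrightarrow> w ! (i' - 1) < w ! (i - 1)"
    and "card {i \<in> A. w ! (i - 1) \<le> v} = length (tab (filter (\<lambda>x. x \<le> v) w))"
proof -
  let ?D = "length (tab w)"
  define r where "r = (\<lambda>i. card {h \<in> A. h \<le> i})"
  define s where "s = (\<lambda>x. card {h \<in> B. h \<le> x})"
  have fin: "finite A" "finite B" by (auto simp: A_def B_def)
  have A: "A \<subseteq> {1..length w}" using snd_rsk(4) by (simp add: A_def)
  have r: "r i = length (tab (take i w))" if "i \<le> length w" for i
    using snd_rsk(5)[OF that] by (simp add: r_def A_def)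
  have s: "s v = length (tab (filter (\<lambda>x. x \<le> v) w))" for v
    using card_column_tab[OF w(1)] by (simp add: s_def B_def)
  have "{h \<in> A. h \<le> length w} = A" using A by auto
  then have cA: "card A = ?D" using r[of "length w"] by (simp add: r_def)
  have B: "B \<subseteq> set w" using column_tab(2)[OF w(1)] by (simp add: B_def)
  have "{h \<in> B. h \<le> Max (set w)} = B" using B by (auto simp: subset_iff)
  moreover have "filter (\<lambda>x. x \<le> Max (set w)) w = w" by (simp add: filter_id_conv)
  ultimately have cB: "card B = ?D" using s[of "Max (set w)"] by (simp add: s_def)
  have inj: "inj_on (\<lambda>i. w ! (i - 1)) A"
    using fin cA cB AB by (intro eq_card_imp_inj_on) simp_all
  have le: "r i + s (w ! (i - 1)) \<le> Suc ?D" if i: "i \<in> A" for i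
  proof -
    let ?x = "w ! (i - 1)"
    have i1: "i \<ge> 1" "i \<le> length w" using A i by auto
    have xB: "?x \<in> B" using i AB by blast
    then have x0: "?x \<noteq> 0" using B w(2) by (metis in_mono)
    have "{h \<in> A. h \<le> i} = insert i {h \<in> A. h \<le> i - 1}" using i i1 by auto
    moreover have "i \<noteq> 0" using i1 by simp
    ultimately have ri: "r i = Suc (r (i - 1))" using fin by (cases i) (simp_all add: r_def)
    have "{h \<in> B. h \<le> ?x} = insert ?x {h \<in> B. h \<le> ?x - 1}" using xB x0 by auto
    then have si: "s ?x = Suc (s (?x - 1))" using fin x0 by (cases ?x) (simp_all add: s_def)
    \<comment> \<open>As \<open>i\<close> is in \<open>A\<close> and its letter in \<open>B\<close>,
      both ranks jump by one there. By Schensted's theorem these jumps are the records required by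
      \<open>dec_through_records\<close>.\<close>
    have "has_dec (Suc (r (i - 1) + s (?x - 1))) w"
    proof (rule dec_through_records[OF w, of "i - 1"])
      show "i - 1 < length w" using i1 by simp
      show "has_dec (Suc (r (i - 1))) (take (Suc (i - 1)) w)" "\<not> has_dec (Suc (r (i - 1))) (take (i - 1) w)"
        using ri r[of i] r[of "i - 1"] i1 w(1) by (auto simp: schensted_rows)
      show "has_dec (Suc (s (?x - 1))) (filter (\<lambda>y. y \<le> ?x) w)"
        "\<not> has_dec (Suc (s (?x - 1))) (filter (\<lambda>y. y \<le> ?x - 1) w)"
        using si s[of ?x] s[of "?x - 1"] w(1) by (auto simp: schensted_rows)
    qed
    then show ?thesis using w(1) ri si by (simp add: schensted_rows)
  qed
  \<comment> \<open>The ranks in \<open>A\<close> and in \<open>B\<close> both run through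
    \<open>1..?D\<close>, so \<open>r + s\<close> has average \<open>Suc ?D\<close>, and a pointwise
    bound by the average must be an equality.\<close>
  have "2 * (\<Sum>i\<in>A. r i) = ?D * Suc ?D" using sum_ranks[OF fin(1)] cA by (simp add: r_def)
  moreover have "2 * (\<Sum>i\<in>A. s (w ! (i - 1))) = ?D * Suc ?D"
    using sum_ranks[OF fin(2)] cB sum.reindex[OF inj, of s] AB by (simp add: s_def)
  ultimately have tot: "(\<Sum>i\<in>A. r i + s (w ! (i - 1))) = (\<Sum>i\<in>A. Suc ?D)"
    using cA by (simp add: sum.distrib)
  have eq: "r i + s (w ! (i - 1)) = Suc ?D" if i: "i \<in> A" for i
  proof (rule ccontr)
    assume "r i + s (w ! (i - 1)) \<noteq> Suc ?D"
    then have "(\<Sum>i\<in>A. r i + s (w ! (i - 1))) < (\<Sum>i\<in>A. Suc ?D)"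
      using le i fin by (intro sum_strict_mono_ex1) (auto simp: less_le)
    then show False using tot by simp
  qed
  show "w ! (i' - 1) < w ! (i - 1)" if i: "i \<in> A" "i' \<in> A" "i < i'" for i i'
  proof (rule ccontr)
    assume "\<not> w ! (i' - 1) < w ! (i - 1)"
    \<comment> \<open>An ascent would raise the rank by position strictly and not lower the rank by
      value, although their sum is constant on \<open>A\<close>.\<close>
    then have "s (w ! (i - 1)) \<le> s (w ! (i' - 1))"
      unfolding s_def using fin by (intro card_mono) auto
    moreover have "r i < r i'"
    proof -
      have "i' \<in> {h \<in> A. h \<le> i'} - {h \<in> A. h \<le> i}" using i by simp
      moreover have "{h \<in> A. h \<le> i} \<subseteq> {h \<in> A. h \<le> i'}" using i by auto
      ultimately show ?thesis unfolding r_def using fin by (intro psubset_card_mono psubsetI) auto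
    qed
    ultimately show False using eq[OF i(1)] eq[OF i(2)] by simp
  qed
  have "(\<lambda>i. w ! (i - 1)) ` {i \<in> A. w ! (i - 1) \<le> v} = {h \<in> B. h \<le> v}" using AB by auto
  then have "card {i \<in> A. w ! (i - 1) \<le> v} = s v"
    unfolding s_def using inj by (metis (no_types, lifting) card_image inj_on_subset mem_Collect_eq subsetI)
  then show "card {i \<in> A. w ! (i - 1) \<le> v} = length (tab (filter (\<lambda>x. x \<le> v) w))" using s by simp
qed

section \<open>Decreasing subsequences as sets of indices\<close>

lemma sorted_wrt_nths:
  "sorted_wrt P (nths w I) \<longleftrightarrow> (\<forall>i\<in>I. \<forall>j\<in>I. i < j \<longrightarrow> j < length w \<longrightarrow> P (w ! i) (w ! j))"
proof (induction w rule: rev_induct)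
  case (snoc x w)
  have "(\<forall>y\<in>set (nths w I). P y x) \<longleftrightarrow> (\<forall>i\<in>I. i < length w \<longrightarrow> P (w ! i) x)"
    by (auto simp: set_nths)
  then show ?case using snoc
    by (auto simp: nths_append sorted_wrt_append nth_append less_Suc_eq dest: less_trans)
qed simp

lemma has_dec_filter_iff:
  "has_dec k (filter Q w) \<longleftrightarrow>
    (\<exists>I \<subseteq> {..<length w}. card I = k \<and> (\<forall>i\<in>I. Q (w ! i)) \<and> (\<forall>i\<in>I. \<forall>j\<in>I. i < j \<longrightarrow> w ! j < w ! i))"
proof
  assume "has_dec k (filter Q w)"
  then obtain xs where xs: "subseq xs (filter Q w)" "sorted_wrt (>) xs" "length xs = k" by (auto simp: has_dec_def)
  have Q: "\<forall>x\<in>set xs. Q x" using xs(1) by (auto simp: subseq_conv_nths dest: in_set_nthsD)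
  have "subseq xs w" using xs(1) subseq_filter_left subseq_order.order_trans by blast
  then obtain N where N: "xs = nths w N" by (auto simp: subseq_conv_nths)
  let ?I = "{i. i < length w \<and> i \<in> N}"
  have "card ?I = k" using xs(3) N by (simp add: length_nths)
  moreover have "\<forall>i\<in>?I. Q (w ! i)" using Q N by (auto simp: set_nths)
  moreover have "\<forall>i\<in>?I. \<forall>j\<in>?I. i < j \<longrightarrow> w ! j < w ! i" using xs(2) by (auto simp: N sorted_wrt_nths)
  ultimately show "\<exists>I \<subseteq> {..<length w}. card I = k \<and> (\<forall>i\<in>I. Q (w ! i)) \<and> (\<forall>i\<in>I. \<forall>j\<in>I. i < j \<longrightarrow> w ! j < w ! i)"
    by (intro exI[of _ ?I]) auto
next
  assume "\<exists>I \<subseteq> {..<length w}. card I = k \<and> (\<forall>i\<in>I. Q (w ! i)) \<and> (\<forall>i\<in>I. \<forall>j\<in>I. i < j \<longrightarrow> w ! j < w ! i)"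
  then obtain I where I: "I \<subseteq> {..<length w}" "card I = k" "\<forall>i\<in>I. Q (w ! i)"
    "\<forall>i\<in>I. \<forall>j\<in>I. i < j \<longrightarrow> w ! j < w ! i" by blast
  have "filter Q (nths w I) = nths w I" using I(3) by (auto simp: filter_id_conv set_nths)
  then have "subseq (nths w I) (filter Q w)" by (metis subseq_conv_nths subseq_filter)
  moreover have "sorted_wrt (>) (nths w I)" using I(4) by (auto simp: sorted_wrt_nths)
  moreover have "{i. i < length w \<and> i \<in> I} = I" using I(1) by auto
  then have "length (nths w I) = k" using I(2) by (simp add: length_nths)
  ultimately show "has_dec k (filter Q w)" by (auto simp: has_dec_def)
qed

section \<open>Monotone patterns in permutations\<close>

text \<open>Composition with the inverse of a fixed member \<open>q\<close> embeds \<open>F\<close>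
  into the permutations that fix \<open>I\<close> pointwise.\<close>

lemma card_permutes_agreeing:
  assumes U: "finite U" and I: "I \<subseteq> U" and F: "F \<subseteq> {p. p permutes U}"
    and agree: "\<And>p p' i. p \<in> F \<Longrightarrow> p' \<in> F \<Longrightarrow> i \<in> I \<Longrightarrow> p i = p' i"
  shows "card F \<le> fact (card U - card I)"
proof (cases "F = {}")
  case False
  then obtain q where q: "q \<in> F" by blast
  then have qU: "q permutes U" using F by auto
  have inj: "inj_on (\<lambda>p. Hilbert_Choice.inv q \<circ> p) F"
  proof (rule inj_onI)
    fix p p' assume "Hilbert_Choice.inv q \<circ> p = Hilbert_Choice.inv q \<circ> p'"
    then have "q \<circ> (Hilbert_Choice.inv q \<circ> p) = q \<circ> (Hilbert_Choice.inv q \<circ> p')" by simp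
    then show "p = p'" using permutes_inv_o(1)[OF qU] by (simp add: o_assoc)
  qed
  have "(\<lambda>p. Hilbert_Choice.inv q \<circ> p) ` F \<subseteq> {p. p permutes (U - I)}"
  proof clarify
    fix p assume p: "p \<in> F"
    then have "Hilbert_Choice.inv q \<circ> p permutes U"
      using F permutes_compose[OF _ permutes_inv[OF qU]] by auto
    moreover have "(Hilbert_Choice.inv q \<circ> p) i = i" if "i \<in> U - (U - I)" for i
      using agree[OF p q] that permutes_inverses(2)[OF qU] by auto
    ultimately show "Hilbert_Choice.inv q \<circ> p permutes (U - I)"
      by (auto intro: permutes_superset)
  qed
  then have "card F \<le> card {p. p permutes (U - I)}"
    using U by (metis card_image[OF inj] card_mono finite_Diff finite_permutations)
  also have "\<dots> = fact (card (U - I))"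
    using U by (intro card_permutations) auto
  also have "card (U - I) = card U - card I"
    using U I by (meson card_Diff_subset finite_subset)
  finally show ?thesis .
qed simp

text \<open>The pattern \<open>R\<close> prescribes the rank of \<open>f i\<close> and of
  \<open>g i\<close> in the common image, and the rank determines the element.\<close>

lemma order_determined:
  fixes f g :: "'a \<Rightarrow> 'b::linorder"
  assumes "finite I" "f ` I = g ` I" "inj_on f I" "inj_on g I"
    and f: "\<And>i j. i \<in> I \<Longrightarrow> j \<in> I \<Longrightarrow> f i < f j \<longleftrightarrow> R i j"
    and g: "\<And>i j. i \<in> I \<Longrightarrow> j \<in> I \<Longrightarrow> g i < g j \<longleftrightarrow> R i j"
    and "i \<in> I"
  shows "f i = g i"
proof -
  let ?rk = "\<lambda>y. card {x \<in> f ` I. x < y}"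
  have rk: "?rk (h i) = card {j \<in> I. R j i}"
    if h: "h ` I = f ` I" "inj_on h I" "\<And>i j. i \<in> I \<Longrightarrow> j \<in> I \<Longrightarrow> h i < h j \<longleftrightarrow> R i j" for h :: "'a \<Rightarrow> 'b"
  proof -
    have "{x \<in> h ` I. x < h i} = h ` {j \<in> I. R j i}" using h(3) assms(7) by blast
    then have "{x \<in> f ` I. x < h i} = h ` {j \<in> I. R j i}" by (simp only: h(1))
    moreover have "inj_on h {j \<in> I. R j i}" using h(2) by (rule inj_on_subset) auto
    ultimately show ?thesis by (simp add: card_image)
  qed
  have eq: "?rk (f i) = ?rk (g i)"
    using rk[OF refl assms(3) f] rk[OF assms(2)[symmetric] assms(4) g] by simp
  have mono: "?rk x < ?rk y" if "x < y" "x \<in> f ` I" for x y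
    using that assms(1) by (intro psubset_card_mono) auto
  show ?thesis
    using eq mono[of "f i" "g i"] mono[of "g i" "f i"] assms(2) imageI[OF assms(7), of f]
      imageI[OF assms(7), of g]
    by (cases rule: linorder_cases[of "f i" "g i"]) simp_all
qed

text \<open>A union bound over the index set \<open>I\<close> and its image \<open>J\<close>: once
  both are chosen, the pattern determines \<open>p\<close> on \<open>I\<close>. Keeping
  \<open>R\<close> general covers increasing and decreasing patterns at once.\<close>

lemma card_permutes_monotone:
  fixes n k :: nat and R :: "nat \<Rightarrow> nat \<Rightarrow> bool"
  assumes X: "X \<subseteq> {..<n}" and Y: "finite Y" and k: "k \<le> n"
  shows "card {p. p permutes {..<n} \<and> (\<exists>I\<subseteq>X. card I = k \<and> p ` I \<subseteq> Y \<and>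
      (\<forall>i\<in>I. \<forall>j\<in>I. p i < p j \<longleftrightarrow> R i j))}
    \<le> (card X choose k) * (card Y choose k) * fact (n - k)"
proof -
  let ?F = "\<lambda>(I, J). {p. p permutes {..<n} \<and> p ` I = J \<and> (\<forall>i\<in>I. \<forall>j\<in>I. p i < p j \<longleftrightarrow> R i j)}"
  let ?Z = "{I. I \<subseteq> X \<and> card I = k} \<times> {J. J \<subseteq> Y \<and> card J = k}"
  have finX: "finite X" using X finite_subset by blast
  have finZ: "finite ?Z" using finX Y by simp
  have sub: "{p. p permutes {..<n} \<and> (\<exists>I\<subseteq>X. card I = k \<and> p ` I \<subseteq> Y \<and>
      (\<forall>i\<in>I. \<forall>j\<in>I. p i < p j \<longleftrightarrow> R i j))} \<subseteq> (\<Union>z\<in>?Z. ?F z)"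
  proof
    fix p assume "p \<in> {p. p permutes {..<n} \<and> (\<exists>I\<subseteq>X. card I = k \<and> p ` I \<subseteq> Y \<and>
      (\<forall>i\<in>I. \<forall>j\<in>I. p i < p j \<longleftrightarrow> R i j))}"
    then obtain I where *: "p permutes {..<n}" "I \<subseteq> X" "card I = k" "p ` I \<subseteq> Y"
      "\<forall>i\<in>I. \<forall>j\<in>I. p i < p j \<longleftrightarrow> R i j" by blast
    have "card (p ` I) = card I"
      using permutes_inj[OF *(1)] by (intro card_image) (rule inj_on_subset, auto)
    then have "(I, p ` I) \<in> ?Z" using * by simp
    moreover have "p \<in> ?F (I, p ` I)" using * by simp
    ultimately show "p \<in> (\<Union>z\<in>?Z. ?F z)" by (rule UN_I)
  qed
  have F: "card (?F z) \<le> fact (n - k)" if z: "z \<in> ?Z" for z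
  proof -
    obtain I J where IJ: "z = (I, J)" "I \<subseteq> X" "card I = k" using z by auto
    have "card (?F z) \<le> fact (card {..<n} - card I)"
    proof (rule card_permutes_agreeing)
      fix p p' i assume "p \<in> ?F z" "p' \<in> ?F z" "i \<in> I"
      then show "p i = p' i"
        using IJ finite_subset[OF _ finX] inj_on_subset[OF permutes_inj, of p "{..<n}" I]
          inj_on_subset[OF permutes_inj, of p' "{..<n}" I]
        by (intro order_determined[of I p p' R i]) simp_all
    qed (use IJ X in auto)
    then show ?thesis using IJ(3) by simp
  qed
  have "finite (\<Union>z\<in>?Z. ?F z)"
    by (rule finite_subset[of _ "{p. p permutes {..<n}}"]) (auto simp: finite_permutations)
  then have "card {p. p permutes {..<n} \<and> (\<exists>I\<subseteq>X. card I = k \<and> p ` I \<subseteq> Y \<and>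
      (\<forall>i\<in>I. \<forall>j\<in>I. p i < p j \<longleftrightarrow> R i j))} \<le> card (\<Union>z\<in>?Z. ?F z)"
    using sub by (rule card_mono)
  also have "\<dots> \<le> (\<Sum>z\<in>?Z. card (?F z))" using finZ by (rule card_UN_le)
  also have "\<dots> \<le> (\<Sum>z\<in>?Z. fact (n - k))" by (rule sum_mono) (rule F)
  also have "\<dots> = (card X choose k) * (card Y choose k) * fact (n - k)"
    using finX Y by (simp add: card_cartesian_product n_subsets)
  finally show ?thesis .
qed

lemma fact_ge_power_div_3: "(real k / 3) ^ k \<le> fact k"
proof (induction k)
  case (Suc k)
  have "(real (Suc k) / 3) ^ Suc k \<le> real (Suc k) * (real k / 3) ^ k"
  proof (cases "k = 0")
    case False
    then have k: "0 < real k" by simp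
    have "(1 + 1 / real k) ^ k \<le> exp 1"
      using exp_ge_one_plus_x_over_n_power_n[of k 1] False by simp
    also have "\<dots> \<le> 3" by (rule exp_le)
    finally have "(1 + 1 / real k) ^ k \<le> 3" .
    then have "(real k) ^ k * (1 + 1 / real k) ^ k \<le> (real k) ^ k * 3" by (intro mult_left_mono) auto
    moreover have "real k * (1 + 1 / real k) = real (Suc k)" using k by (simp add: field_simps)
    ultimately have "real (Suc k) ^ k \<le> real k ^ k * 3" by (metis power_mult_distrib)
    then have "real (Suc k) / 3 * (real (Suc k) ^ k / 3 ^ k) \<le> real (Suc k) / 3 * (real k ^ k * 3 / 3 ^ k)"
      by (intro mult_left_mono divide_right_mono) auto
    then show ?thesis by (simp add: power_divide)
  qed simp
  also have "\<dots> \<le> real (Suc k) * fact k" using Suc by (intro mult_left_mono) auto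
  finally show ?case by simp
qed simp

lemma binomial_le_power_div_fact: "real (b choose k) \<le> real b ^ k / fact k"
proof -
  have "fact k * (b choose k) \<le> b ^ k" by (metis binomial_fact_pow mult.commute)
  then have "real (fact k * (b choose k)) \<le> real (b ^ k)" by (simp only: of_nat_le_iff)
  then show ?thesis by (simp add: field_simps)
qed

text \<open>Each factor \<open>a - i\<close> is at most \<open>a / n\<close> times
  \<open>n - i\<close>. This measures what is gained by confining \<open>k\<close> positions to a
  window of size \<open>a\<close>.\<close>

lemma binomial_ratio_le:
  assumes "a \<le> n" "0 < n"
  shows "real (a choose k) \<le> (real a / real n) ^ k * real (n choose k)"
proof (cases "k \<le> a")
  case True
  have "real (a choose k) = (\<Prod>i = 0..<k. real (a - i) / real (k - i))"
    using True by (rule binomial_altdef_of_nat)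
  also have "\<dots> \<le> (\<Prod>i = 0..<k. real a / real n * (real (n - i) / real (k - i)))"
  proof (rule prod_mono)
    fix i assume "i \<in> {0..<k}"
    then have i: "i < a" "i < k" using True by auto
    then have "real (a - i) * real n \<le> real a * real (n - i)"
      using assms(1) mult_left_mono[of "real a" "real n" "real i"] by (simp add: of_nat_diff algebra_simps)
    then have "real (a - i) \<le> real a / real n * real (n - i)"
      using assms(2) by (simp add: field_simps)
    then have "real (a - i) / real (k - i) \<le> real a / real n * real (n - i) / real (k - i)"
      by (rule divide_right_mono) simp
    then show "0 \<le> real (a - i) / real (k - i) \<and>
        real (a - i) / real (k - i) \<le> real a / real n * (real (n - i) / real (k - i))"
      by simp
  qed
  also have "\<dots> = (real a / real n) ^ k * (\<Prod>i = 0..<k. real (n - i) / real (k - i))"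
    by (simp only: prod.distrib prod_constant card_atLeastLessThan diff_zero)
  also have "(\<Prod>i = 0..<k. real (n - i) / real (k - i)) = real (n choose k)"
    using True assms(1) by (intro binomial_altdef_of_nat[symmetric]) simp
  finally show ?thesis .
qed (simp add: binomial_eq_0)

text \<open>Label each \<open>i\<close> by \<open>d i\<close>, the largest size of a decreasing
  subset ending at \<open>i\<close>. Labels lie in \<open>1..L\<close>, and points with equal labels
  form an increasing set, hence number at most \<open>K\<close>.\<close>

lemma Erdos_Szekeres:
  fixes p :: "'a::linorder \<Rightarrow> 'b::linorder"
  assumes X: "finite X" "inj_on p X"
    and dec: "\<And>I. I \<subseteq> X \<Longrightarrow> \<forall>i\<in>I. \<forall>j\<in>I. i < j \<longrightarrow> p j < p i \<Longrightarrow> card I \<le> L"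
    and inc: "\<And>I. I \<subseteq> X \<Longrightarrow> \<forall>i\<in>I. \<forall>j\<in>I. i < j \<longrightarrow> p i < p j \<Longrightarrow> card I \<le> K"
  shows "card X \<le> L * K"
proof -
  define E where "E = (\<lambda>i. {I. I \<subseteq> X \<and> (\<forall>i\<in>I. \<forall>j\<in>I. i < j \<longrightarrow> p j < p i) \<and> i \<in> I \<and> (\<forall>j\<in>I. j \<le> i)})"
  define d where "d = (\<lambda>i. Max (card ` E i))"
  have finE: "finite (E i)" for i
    using X(1) by (auto intro!: finite_subset[of "E i" "Pow X"] simp: E_def)
  have single: "{i} \<in> E i" if "i \<in> X" for i using that by (simp add: E_def)
  have d_in: "\<exists>I\<in>E i. card I = d i" if "i \<in> X" for i
  proof -
    have "Max (card ` E i) \<in> card ` E i" using finE single[OF that] by (intro Max_in) auto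
    then show ?thesis unfolding d_def by (metis imageE)
  qed
  have d_ge: "card I \<le> d i" if "I \<in> E i" for i I
    unfolding d_def using that finE by (intro Max_ge) auto
  have d_pos: "1 \<le> d i" if "i \<in> X" for i using d_ge[OF single[OF that]] by simp
  have d_le: "d i \<le> L" if i: "i \<in> X" for i
  proof -
    obtain I where "I \<in> E i" "card I = d i" using d_in[OF i] by blast
    then show ?thesis using dec[of I] by (simp add: E_def)
  qed
  have d_less: "d i < d j" if ij: "i \<in> X" "j \<in> X" "i < j" "p j < p i" for i j
  proof -
    obtain I where I: "I \<in> E i" "card I = d i" using d_in[OF ij(1)] by blast
    have IE: "I \<subseteq> X" "\<forall>i\<in>I. \<forall>j\<in>I. i < j \<longrightarrow> p j < p i" "i \<in> I" "\<forall>j\<in>I. j \<le> i"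
      using I(1) by (simp_all add: E_def)
    have pl: "p j < p l" if "l \<in> I" for l
    proof (cases "l = i")
      case False
      then have "p i < p l" using IE that by (simp add: le_neq_trans)
      then show ?thesis using ij(4) by simp
    qed (use ij in simp)
    have lt: "l < j" if "l \<in> I" for l using IE(4) that ij(3) by (meson le_less_trans)
    have "\<forall>a\<in>insert j I. \<forall>b\<in>insert j I. a < b \<longrightarrow> p b < p a"
      using IE(2) pl lt by (metis insert_iff less_asym less_irrefl)
    then have "insert j I \<in> E j"
      using IE(1) ij(2) lt less_imp_le by (fastforce simp: E_def)
    moreover have "j \<notin> I" using lt by blast
    moreover have "finite I" using IE(1) X(1) by (rule finite_subset)
    ultimately show ?thesis using d_ge[of "insert j I" j] I(2) by simp
  qed
  have "card {i \<in> X. d i = c} \<le> K" for c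
  proof (rule inc)
    show "\<forall>i\<in>{i \<in> X. d i = c}. \<forall>j\<in>{i \<in> X. d i = c}. i < j \<longrightarrow> p i < p j"
    proof (intro ballI impI)
      fix i j assume ij: "i \<in> {i \<in> X. d i = c}" "j \<in> {i \<in> X. d i = c}" "i < j"
      then have "\<not> p j < p i" using d_less[of i j] by auto
      moreover have "p i \<noteq> p j" using ij X(2) by (auto dest: inj_onD)
      ultimately show "p i < p j" by simp
    qed
  qed simp
  then have "(\<Sum>c\<in>{1..L}. card {i \<in> X. d i = c}) \<le> (\<Sum>c\<in>{1..L}. K)" by (intro sum_mono)
  moreover have Xeq: "X = (\<Union>c\<in>{1..L}. {i \<in> X. d i = c})" using d_pos d_le by auto
  moreover have "card X \<le> (\<Sum>c\<in>{1..L}. card {i \<in> X. d i = c})"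
    by (intro ord_eq_le_trans[OF arg_cong[OF Xeq, of card]] card_UN_le) simp
  ultimately show ?thesis by simp
qed

text \<open>The exact equivalence in the order condition has the shape of the pattern
  \<open>R\<close> in \<open>card_permutes_monotone\<close>. Values count from 0 and
  \<open>v\<close> is an exclusive bound.\<close>

definition dec_in :: "(nat \<Rightarrow> nat) \<Rightarrow> nat \<Rightarrow> nat set \<Rightarrow> nat \<Rightarrow> bool" where
  "dec_in p k X v \<longleftrightarrow> (\<exists>I\<subseteq>X. card I = k \<and> p ` I \<subseteq> {..<v} \<and> (\<forall>i\<in>I. \<forall>j\<in>I. p i < p j \<longleftrightarrow> j < i))"

definition inc_in :: "(nat \<Rightarrow> nat) \<Rightarrow> nat \<Rightarrow> nat set \<Rightarrow> nat \<Rightarrow> bool" where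
  "inc_in p k X v \<longleftrightarrow> (\<exists>I\<subseteq>X. card I = k \<and> p ` I \<subseteq> {..<v} \<and> (\<forall>i\<in>I. \<forall>j\<in>I. p i < p j \<longleftrightarrow> i < j))"

lemma dec_inI:
  assumes "I \<subseteq> X" "k \<le> card I" "p ` I \<subseteq> {..<v}" "\<forall>i\<in>I. \<forall>j\<in>I. i < j \<longrightarrow> p j < p i"
  shows "dec_in p k X v"
proof -
  obtain J where J: "J \<subseteq> I" "card J = k" using assms(2) obtain_subset_with_card_n by blast
  moreover have "p i < p j \<longleftrightarrow> j < i" if "i \<in> J" "j \<in> J" for i j
    using that J(1) assms(4) by (cases rule: linorder_cases[of i j]) (auto dest: less_asym)
  ultimately show ?thesis using assms(1) subset_trans[OF image_mono[OF J(1)] assms(3)] unfolding dec_in_def by (intro exI[of _ J]) simp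
qed

lemma inc_inI:
  assumes "I \<subseteq> X" "k \<le> card I" "p ` I \<subseteq> {..<v}" "\<forall>i\<in>I. \<forall>j\<in>I. i < j \<longrightarrow> p i < p j"
  shows "inc_in p k X v"
proof -
  obtain J where J: "J \<subseteq> I" "card J = k" using assms(2) obtain_subset_with_card_n by blast
  moreover have "p i < p j \<longleftrightarrow> i < j" if "i \<in> J" "j \<in> J" for i j
    using that J(1) assms(4) by (cases rule: linorder_cases[of i j]) (auto dest: less_asym)
  ultimately show ?thesis using assms(1) subset_trans[OF image_mono[OF J(1)] assms(3)] unfolding inc_in_def by (intro exI[of _ J]) simp
qed

text \<open>
  With \<open>L j\<close> the number of points of the diagram \<open>A\<close> of height below \<open>v j\<close>, the bounds on monotone
  subsequences and the theorem of Erdos and Szekeres give \<open>2 * q j < L j\<close> and \<open>L (Suc j) < q j\<close>.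
  So each of the horizontal slabs contains more than \<open>q j\<close> points of \<open>A\<close>, which by \<open>no_win\<close> spread
  over at least \<open>m\<close> positions; as \<open>A\<close> is decreasing, different slabs use different positions.
\<close>

lemma decreasing_diagram_impossible:
  fixes p :: "nat \<Rightarrow> nat" and v q :: "nat \<Rightarrow> nat"
  assumes p: "bij_betw p {..<n} {..<n}" and A: "A \<subseteq> {..<n}"
    and A_dec: "\<And>i j. i \<in> A \<Longrightarrow> j \<in> A \<Longrightarrow> i < j \<Longrightarrow> p j < p i"
    and A_card: "\<And>k u. dec_in p k {..<n} u \<longleftrightarrow> k \<le> card {i \<in> A. p i < u}"
    and v: "\<And>j. j \<le> Suc R \<Longrightarrow> v j = 144 * (q j)\<^sup>2" "\<And>j. j \<le> Suc R \<Longrightarrow> v j \<le> n"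
    and q: "\<And>j. j \<le> Suc R \<Longrightarrow> 0 < q j" "\<And>j. j \<le> R \<Longrightarrow> q j = 72 * q (Suc j)"
    and no_dec: "\<And>j. j \<le> Suc R \<Longrightarrow> \<not> dec_in p (72 * q j) {..<n} (v j)"
    and no_inc: "\<And>j. j \<le> Suc R \<Longrightarrow> \<not> inc_in p (72 * q j) {..<n} (v j)"
    and no_win: "\<And>j a. j \<le> R \<Longrightarrow> a < n \<Longrightarrow> \<not> dec_in p (q j) ({a..<a + m} \<inter> {..<n}) (v j)"
    and m: "n \<le> R * m"
  shows False
proof -
  have finA: "finite A" using A finite_subset by blast
  define L where "L = (\<lambda>j. card {i \<in> A. p i < v j})"
  have L_less: "L j < 72 * q j" if "j \<le> Suc R" for j
    using no_dec[OF that] A_card by (simp add: L_def not_le)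
  have L_ge: "2 * q j < L j" if j: "j \<le> Suc R" for j
  proof -
    let ?X = "{i \<in> {..<n}. p i < v j}"
    have "{..<v j} \<subseteq> p ` {..<n}" using p v(2)[OF j] by (auto simp: bij_betw_def)
    then have "p ` ?X = {..<v j}" by auto
    moreover have inj: "inj_on p ?X" using p by (auto simp: bij_betw_def intro: inj_on_subset)
    ultimately have "card ?X = v j" by (metis card_image card_lessThan)
    moreover have "card ?X \<le> L j * (72 * q j - 1)"
    proof (rule Erdos_Szekeres)
      fix I assume I: "I \<subseteq> ?X"
      { assume "\<forall>i\<in>I. \<forall>j\<in>I. i < j \<longrightarrow> p j < p i"
        then have "dec_in p (card I) {..<n} (v j)" using I by (intro dec_inI[of I]) auto
        then show "card I \<le> L j" using A_card by (simp add: L_def) }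
      { assume *: "\<forall>i\<in>I. \<forall>j\<in>I. i < j \<longrightarrow> p i < p j"
        show "card I \<le> 72 * q j - 1"
        proof (rule ccontr)
          assume "\<not> card I \<le> 72 * q j - 1"
          then have "inc_in p (72 * q j) {..<n} (v j)" using * I by (intro inc_inI[of I]) auto
          then show False using no_inc[OF j] by simp
        qed }
    qed (use inj in auto)
    \<comment> \<open>The subtracted 1, which comes from \<open>no_inc\<close>, makes the resulting
      bound \<open>2 * q j < L j\<close> strict.\<close>
    ultimately have "144 * (q j)\<^sup>2 \<le> L j * (72 * q j - 1)" using v(1)[OF j] by simp
    also have "\<dots> < L j * (72 * q j)" if "0 < L j" using that q(1)[OF j] by simp
    finally have *: "144 * (q j)\<^sup>2 < L j * (72 * q j)" if "0 < L j" using that by blast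
    show ?thesis
    proof (rule ccontr)
      assume "\<not> 2 * q j < L j"
      then have "L j * (72 * q j) \<le> 2 * q j * (72 * q j)" by (intro mult_right_mono) auto
      also have "\<dots> = 144 * (q j)\<^sup>2" by (simp add: power2_eq_square)
      finally have "L j = 0" using * by (metis bot_nat_0.not_eq_extremum not_le)
      then show False using \<open>144 * (q j)\<^sup>2 \<le> L j * (72 * q j - 1)\<close> q(1)[OF j] by simp
    qed
  qed
  define S where "S = (\<lambda>j. {i \<in> A. v (Suc j) \<le> p i \<and> p i < v j})"
  define a where "a = (\<lambda>j. Min (S j))"
  have finS: "finite (S j)" for j using finA by (simp add: S_def)
  have SA: "S j \<subseteq> A" for j by (auto simp: S_def)
  have cardS: "q j < card (S j)" if j: "j \<le> R" for j
  proof -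
    have "q (Suc j) \<le> q j" using q(2)[OF j] by simp
    then have "v (Suc j) \<le> v j" using v(1)[of j] v(1)[of "Suc j"] j by (simp add: power_mono)
    then have "{i \<in> A. p i < v j} = S j \<union> {i \<in> A. p i < v (Suc j)}" by (auto simp: S_def)
    moreover have "S j \<inter> {i \<in> A. p i < v (Suc j)} = {}" by (auto simp: S_def)
    ultimately have "L j = card (S j) + L (Suc j)"
      using finA finS by (simp add: L_def card_Un_disjoint)
    \<comment> \<open>The ratio 72 between consecutive \<open>q\<close> turns the upper bound for
      the next \<open>L\<close> into \<open>q j\<close>, half of the lower bound for
      \<open>L j\<close>.\<close>
    moreover have "L (Suc j) < q j" using L_less[of "Suc j"] q(2)[OF j] j by simp
    ultimately show ?thesis using L_ge[of j] j by simp
  qed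
  have a_in: "a j \<in> S j" if "j \<le> R" for j
    unfolding a_def using cardS[OF that] finS by (intro Min_in) auto
  have step: "a j + m \<le> a (Suc j)" if j: "Suc j \<le> R" for j
  proof (rule ccontr)
    assume neg: "\<not> a j + m \<le> a (Suc j)"
    have "S j \<subseteq> {a j..<a j + m} \<inter> {..<n}"
    proof
      fix i assume i: "i \<in> S j"
      have "a j \<le> i" unfolding a_def using finS i by simp
      moreover have "p (a (Suc j)) < p i" using a_in[OF j] i by (auto simp: S_def)
      \<comment> \<open>Slab \<open>Suc j\<close> lies below slab \<open>j\<close> and
        \<open>A\<close> is decreasing, so all of \<open>S j\<close> is to the left of
        \<open>a (Suc j)\<close>.\<close>
      then have "i < a (Suc j)"
        using A_dec[of "a (Suc j)" i] a_in[OF j] i SA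
        by (metis in_mono less_asym less_irrefl linorder_neqE_nat)
      moreover have "i < n" using i SA A by blast
      ultimately show "i \<in> {a j..<a j + m} \<inter> {..<n}" using neg by simp
    qed
    then have "dec_in p (q j) ({a j..<a j + m} \<inter> {..<n}) (v j)"
      using cardS[of j] j A_dec SA by (intro dec_inI[of "S j"]) (auto simp: S_def)
    moreover have "a j < n" using a_in[of j] j SA A by fastforce
    ultimately show False using no_win[of j "a j"] j by simp
  qed
  \<comment> \<open>The leftmost point advances by at least \<open>m\<close> per slab and after
    \<open>R\<close> slabs has left the available positions.\<close>
  have "j \<le> R \<Longrightarrow> j * m \<le> a j" for j
  proof (induction j)
    case (Suc j)
    then show ?case using step[of j] by simp
  qed simp
  then have "n \<le> a R" using m le_trans by blast
  moreover have "a R < n" using a_in[of R] SA A by fastforce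
  ultimately show False by simp
qed

section \<open>Coefficients of bitableaux\<close>

text \<open>Monomials of a minor come from the Leibniz expansion. A non-square \<open>det\<close> is
  0 by convention, so having a monomial at all forces equal lengths.\<close>

lemma keys_z_minor:
  assumes "e \<in> Poly_Mapping.keys (z_minor rs cs)"
  obtains q where "length rs = length cs" "q permutes {..<length rs}"
    "e = (\<Sum>a<length rs. Poly_Mapping.single (rs ! a, cs ! q a) 1)"
proof -
  let ?M = "mat (length rs) (length cs) (\<lambda>(a, b). z (rs ! a) (cs ! b))"
  have len: "length rs = length cs"
    using assms by (auto simp: z_minor_def det_def split: if_splits)
  have e: "e \<in> Poly_Mapping.keys (\<Sum>q\<in>{q. q permutes {0..<length rs}}. signof q * (\<Prod>i = 0..<length rs. ?M $$ (i, q i)))"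
    using assms len by (simp add: z_minor_def det_def)
  then obtain q where q: "q permutes {0..<length rs}"
    "e \<in> Poly_Mapping.keys (signof q * (\<Prod>i = 0..<length rs. ?M $$ (i, q i)))"
    using subsetD[OF keys_sum e] by auto
  have "(\<Prod>i = 0..<length rs. ?M $$ (i, q i)) =
      (\<Prod>i<length rs. Poly_Mapping.single (Poly_Mapping.single (rs ! i, cs ! q i) 1) 1)"
    using len permutes_in_image[OF q(1)]
    by (intro prod.cong) (auto simp: z_def atLeast0LessThan)
  also have "\<dots> = Poly_Mapping.single (\<Sum>i<length rs. Poly_Mapping.single (rs ! i, cs ! q i) 1) 1"
    by (rule prod_monomials) simp
  finally have "e \<in> Poly_Mapping.keys (signof q * Poly_Mapping.single (\<Sum>i<length rs. Poly_Mapping.single (rs ! i, cs ! q i) 1) (1::int))"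
    using q(2) by simp
  then have "e = (\<Sum>i<length rs. Poly_Mapping.single (rs ! i, cs ! q i) 1)"
    by (auto simp: sign_def split: if_splits)
  then show ?thesis using that len q(1) by (simp add: atLeast0LessThan)
qed

lemma lookup_mat_exp_nonzero:
  assumes "Poly_Mapping.lookup (mat_exp \<alpha>) (x, y) \<noteq> 0"
  obtains i j where "i < dim_row \<alpha>" "j < dim_col \<alpha>" "x = Suc i" "y = Suc j" "\<alpha> $$ (i, j) \<noteq> 0"
proof -
  have "(\<Sum>i<dim_row \<alpha>. \<Sum>j<dim_col \<alpha>. Poly_Mapping.lookup (Poly_Mapping.single (Suc i, Suc j) (\<alpha> $$ (i, j))) (x, y)) \<noteq> 0"
    using assms by (simp add: mat_exp_def lookup_sum)
  then obtain i where i: "i \<in> {..<dim_row \<alpha>}"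
    "(\<Sum>j<dim_col \<alpha>. Poly_Mapping.lookup (Poly_Mapping.single (Suc i, Suc j) (\<alpha> $$ (i, j))) (x, y)) \<noteq> 0"
    by (rule sum.not_neutral_contains_not_neutral)
  from i(2) obtain j where j: "j \<in> {..<dim_col \<alpha>}"
    "Poly_Mapping.lookup (Poly_Mapping.single (Suc i, Suc j) (\<alpha> $$ (i, j))) (x, y) \<noteq> 0"
    by (rule sum.not_neutral_contains_not_neutral)
  then show ?thesis using i(1) that[of i j] by (auto simp: lookup_single when_def split: if_splits)
qed

text \<open>The monomial splits as \<open>e + f\<close> with \<open>e\<close> from the minor of the
  first columns. Exponents are natural numbers, so \<open>f\<close> cannot cancel \<open>e\<close>,
  and the permutation behind \<open>e\<close> matches the two columns.\<close>

lemma bitableau_coeff_nonzero: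
  assumes "coeff_of_mat (bitableau P Q) \<alpha> \<noteq> 0" "0 < num_columns P"
  shows "\<forall>x\<in>set (column P 0). \<exists>y\<in>set (column Q 0). Poly_Mapping.lookup (mat_exp \<alpha>) (x, y) \<noteq> 0"
    and "\<forall>y\<in>set (column Q 0). \<exists>x\<in>set (column P 0). Poly_Mapping.lookup (mat_exp \<alpha>) (x, y) \<noteq> 0"
proof -
  obtain N where N: "num_columns P = Suc N" using assms(2) gr0_conv_Suc by blast
  let ?rs = "sort (column P 0)" and ?cs = "sort (column Q 0)"
  have me: "mat_exp \<alpha> \<in> Poly_Mapping.keys (z_minor ?rs ?cs *
      (\<Prod>j<N. z_minor (sort (column P (Suc j))) (sort (column Q (Suc j)))))"
    using assms(1) unfolding coeff_of_mat_def bitableau_def N prod.lessThan_Suc_shift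
    by (simp add: in_keys_iff)
  then obtain e f where ef: "mat_exp \<alpha> = e + f" "e \<in> Poly_Mapping.keys (z_minor ?rs ?cs)"
    using subsetD[OF keys_mult me] by blast
  obtain q where q: "length ?rs = length ?cs" "q permutes {..<length ?rs}"
    "e = (\<Sum>a<length ?rs. Poly_Mapping.single (?rs ! a, ?cs ! q a) 1)"
    using keys_z_minor[OF ef(2)] .
  have nz: "Poly_Mapping.lookup (mat_exp \<alpha>) (?rs ! a, ?cs ! q a) \<noteq> 0" if a: "a < length ?rs" for a
  proof -
    have "1 \<le> Poly_Mapping.lookup (Poly_Mapping.single (?rs ! a, ?cs ! q a) (1::nat)) (?rs ! a, ?cs ! q a)"
      by simp
    also have "\<dots> \<le> (\<Sum>b<length ?rs. Poly_Mapping.lookup (Poly_Mapping.single (?rs ! b, ?cs ! q b) 1) (?rs ! a, ?cs ! q a))"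
      using a by (intro member_le_sum) auto
    also have "\<dots> = Poly_Mapping.lookup e (?rs ! a, ?cs ! q a)"
      by (simp only: q(3) lookup_sum)
    finally show ?thesis by (simp add: ef(1) lookup_add)
  qed
  show "\<forall>x\<in>set (column P 0). \<exists>y\<in>set (column Q 0). Poly_Mapping.lookup (mat_exp \<alpha>) (x, y) \<noteq> 0"
  proof
    fix x assume "x \<in> set (column P 0)"
    then have "x \<in> set ?rs" by simp
    then obtain a where a: "a < length ?rs" "?rs ! a = x" by (meson in_set_conv_nth)
    moreover have "q a < length ?cs" using a permutes_in_image[OF q(2), of a] q(1) by auto
    then have "?cs ! q a \<in> set (column Q 0)" by (metis nth_mem set_sort)
    ultimately show "\<exists>y\<in>set (column Q 0). Poly_Mapping.lookup (mat_exp \<alpha>) (x, y) \<noteq> 0"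
      using nz by metis
  qed
  show "\<forall>y\<in>set (column Q 0). \<exists>x\<in>set (column P 0). Poly_Mapping.lookup (mat_exp \<alpha>) (x, y) \<noteq> 0"
  proof
    fix y assume "y \<in> set (column Q 0)"
    then have "y \<in> set ?cs" by simp
    then obtain b where b: "b < length ?cs" "?cs ! b = y" by (meson in_set_conv_nth)
    then obtain a where a: "a < length ?rs" "q a = b"
      using permutes_image[OF q(2)] q(1) by (metis imageE lessThan_iff)
    then have "?rs ! a \<in> set (column P 0)" by (metis nth_mem set_sort)
    then show "\<exists>x\<in>set (column P 0). Poly_Mapping.lookup (mat_exp \<alpha>) (x, y) \<noteq> 0"
      using nz[OF a(1)] a(2) b(2) by metis
  qed
qed

section \<open>Permutation matrices as permutations\<close>

definition perm_mat :: "nat \<Rightarrow> (nat \<Rightarrow> nat) \<Rightarrow> nat mat" where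
  "perm_mat n p = mat n n (\<lambda>(i, j). if p j = i then 1 else 0)"

lemma perm_mat_in:
  assumes p: "p permutes {..<n}"
  shows "perm_mat n p \<in> permutation_matrices n"
proof -
  have "\<exists>!j. j < n \<and> perm_mat n p $$ (i, j) = 1" if i: "i < n" for i
  proof (rule ex1I[of _ "Hilbert_Choice.inv p i"])
    show "Hilbert_Choice.inv p i < n \<and> perm_mat n p $$ (i, Hilbert_Choice.inv p i) = 1"
      using permutes_in_image[OF permutes_inv[OF p], of i] permutes_inverses[OF p] i
      by (auto simp: perm_mat_def)
    show "j = Hilbert_Choice.inv p i" if "j < n \<and> perm_mat n p $$ (i, j) = 1" for j
      using that i permutes_inverses[OF p] by (auto simp: perm_mat_def split: if_splits)
  qed
  moreover have "\<exists>!i. i < n \<and> perm_mat n p $$ (i, j) = 1" if j: "j < n" for j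
  proof (rule ex1I[of _ "p j"])
    have "p j < n" using permutes_in_image[OF p, of j] j by simp
    then show "p j < n \<and> perm_mat n p $$ (p j, j) = 1" using j by (simp add: perm_mat_def)
    show "i = p j" if "i < n \<and> perm_mat n p $$ (i, j) = 1" for i
      using that j by (auto simp: perm_mat_def split: if_splits)
  qed
  ultimately show ?thesis by (simp add: permutation_matrices_def perm_mat_def)
qed

lemma perm_mat_inj: "inj_on (perm_mat n) {p. p permutes {..<n}}"
proof (rule inj_onI, rule ext)
  fix p q j assume pq: "p \<in> {p. p permutes {..<n}}" "q \<in> {p. p permutes {..<n}}" "perm_mat n p = perm_mat n q"
  show "p j = q j"
  proof (cases "j < n")
    case True
    then have "p j < n" using pq(1) permutes_in_image by fastforce
    then have "perm_mat n p $$ (p j, j) = 1" using True by (simp add: perm_mat_def)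
    then show ?thesis using True \<open>p j < n\<close> unfolding pq(3) by (auto simp: perm_mat_def split: if_splits)
  next
    case False
    then show ?thesis using pq by (simp add: permutes_def)
  qed
qed

lemma perm_mat_surj:
  assumes a: "\<alpha> \<in> permutation_matrices n"
  obtains p where "p permutes {..<n}" "\<alpha> = perm_mat n p"
proof -
  have car: "\<alpha> \<in> carrier_mat n n" and val: "\<And>i j. i < n \<Longrightarrow> j < n \<Longrightarrow> \<alpha> $$ (i, j) \<in> {0, 1}"
    and row: "\<And>i. i < n \<Longrightarrow> \<exists>!j. j < n \<and> \<alpha> $$ (i, j) = 1"
    and col: "\<And>j. j < n \<Longrightarrow> \<exists>!i. i < n \<and> \<alpha> $$ (i, j) = 1"
    using a by (auto simp: permutation_matrices_def)
  define p where "p = (\<lambda>j. if j < n then THE i. i < n \<and> \<alpha> $$ (i, j) = 1 else j)"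
  have pj: "p j < n" "\<alpha> $$ (p j, j) = 1" if "j < n" for j
    using theI'[OF col[OF that]] that by (auto simp: p_def)
  have peq: "p j = i" if "j < n" "i < n" "\<alpha> $$ (i, j) = 1" for i j
    using col[OF that(1)] pj[OF that(1)] that by blast
  have "bij_betw p {..<n} {..<n}"
    unfolding bij_betw_def
  proof
    show "inj_on p {..<n}"
    proof (rule inj_onI)
      fix j k assume jk: "j \<in> {..<n}" "k \<in> {..<n}" "p j = p k"
      then show "j = k" using row[of "p j"] pj by (metis lessThan_iff)
    qed
    show "p ` {..<n} = {..<n}"
    proof
      show "{..<n} \<subseteq> p ` {..<n}"
      proof
        fix i assume i: "i \<in> {..<n}"
        then obtain j where "j < n" "\<alpha> $$ (i, j) = 1" using row by blast
        then have "p j = i" using peq i by simp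
        then show "i \<in> p ` {..<n}" using \<open>j < n\<close> by blast
      qed
    qed (use pj in auto)
  qed
  then have "p permutes {..<n}" by (rule bij_imp_permutes) (simp add: p_def)
  moreover have "\<alpha> = perm_mat n p"
  proof (rule eq_matI)
    fix i j assume "i < dim_row (perm_mat n p)" "j < dim_col (perm_mat n p)"
    then have ij: "i < n" "j < n" by (auto simp: perm_mat_def)
    then show "\<alpha> $$ (i, j) = perm_mat n p $$ (i, j)"
      using val[OF ij] peq[OF ij(2,1)] pj[OF ij(2)] by (auto simp: perm_mat_def)
  qed (use car in \<open>auto simp: perm_mat_def\<close>)
  ultimately show ?thesis by (rule that)
qed

lemma perm_word_perm_mat:
  assumes p: "p permutes {..<n}"
  shows "perm_word (perm_mat n p) = map (\<lambda>j. Suc (p j)) [0..<n]"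
proof -
  have "(THE i. i < n \<and> perm_mat n p $$ (i, j) = 1) = p j" if "j < n" for j
    using permutes_in_image[OF p, of j] that
    by (intro the_equality) (auto simp: perm_mat_def split: if_splits)
  then show ?thesis by (simp add: perm_word_def perm_mat_def)
qed

section \<open>Almost all coefficients vanish\<close>

text \<open>After inserting the binomial bounds, \<open>(n choose k) * fact (n - k)\<close> becomes
  \<open>fact n / fact k\<close>. This leaves two factors \<open>1 / fact k\<close>, each at most
  \<open>(3 / k)^k\<close>, whence the 9 and the square of \<open>k\<close>.\<close>

lemma card_pattern_bound:
  assumes X: "X \<subseteq> {..<n}" "card X \<le> m" and m: "m \<le> n" and k: "0 < k" "k \<le> n"
  shows "real (card {p. p permutes {..<n} \<and> (\<exists>I\<subseteq>X. card I = k \<and> p ` I \<subseteq> {..<v} \<and>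
      (\<forall>i\<in>I. \<forall>j\<in>I. p i < p j \<longleftrightarrow> R i j))})
    \<le> fact n * (real m / real n * (9 * real v / (real k)\<^sup>2)) ^ k" (is "real (card ?S) \<le> _")
proof -
  have n: "0 < n" using k by simp
  have "card ?S \<le> (card X choose k) * (card {..<v} choose k) * fact (n - k)"
    using X(1) k(2) by (intro card_permutes_monotone) auto
  then have "real (card ?S) \<le> real ((card X choose k) * (card {..<v} choose k) * fact (n - k))"
    by (simp only: of_nat_le_iff)
  also have "\<dots> = real (card X choose k) * real (v choose k) * fact (n - k)" by simp
  also have "\<dots> \<le> ((real m / real n) ^ k * real (n choose k)) * (real v ^ k / fact k) * fact (n - k)"
  proof (intro mult_right_mono mult_mono)
    have "real (card X choose k) \<le> (real (card X) / real n) ^ k * real (n choose k)"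
      using X(2) m n by (intro binomial_ratio_le) auto
    also have "\<dots> \<le> (real m / real n) ^ k * real (n choose k)"
      using X(2) by (intro mult_right_mono power_mono divide_right_mono) auto
    finally show "real (card X choose k) \<le> (real m / real n) ^ k * real (n choose k)" .
  qed (use binomial_le_power_div_fact in auto)
  also have "\<dots> = fact n * (real m / real n * real v) ^ k * (1 / fact k) ^ 2"
  proof -
    have "real (n choose k) = fact n / (fact k * fact (n - k))" using k(2) by (rule binomial_fact)
    then show ?thesis by (simp add: power_mult_distrib power_divide power2_eq_square)
  qed
  also have "\<dots> \<le> fact n * (real m / real n * real v) ^ k * ((3 / real k) ^ k) ^ 2"
  proof (intro mult_left_mono power_mono)
    have "1 / fact k \<le> 1 / (real k / 3) ^ k"
      using fact_ge_power_div_3[of k] k(1) by (intro divide_left_mono) auto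
    then show "1 / fact k \<le> (3 / real k) ^ k" by (simp add: power_divide)
  qed auto
  also have "\<dots> = fact n * (real m / real n * (9 * real v / (real k)\<^sup>2)) ^ k"
  proof -
    have "((3 / real k) ^ k) ^ 2 = ((3 / real k) ^ 2) ^ k"
      by (simp only: power_mult[symmetric] mult.commute)
    then have "fact n * (real m / real n * real v) ^ k * ((3 / real k) ^ k) ^ 2 =
        fact n * (real m / real n * real v * (3 / real k) ^ 2) ^ k"
      by (simp only: power_mult_distrib mult.assoc)
    also have "real m / real n * real v * (3 / real k) ^ 2 = real m / real n * (9 * real v / (real k)\<^sup>2)"
      by (simp add: power_divide)
    finally show ?thesis .
  qed
  finally show ?thesis .
qed

text \<open>Transfers \<open>first_columns_decreasing\<close> to \<open>p\<close> with indices from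
  0; the letters are \<open>Suc (p i)\<close>, so a letter at most \<open>u\<close> means
  \<open>p i < u\<close>. The hypothesis on the columns holds because a nonzero exponent at
  \<open>(x, y)\<close> says that the letter in position \<open>y\<close> is
  \<open>x\<close>.\<close>

lemma first_column_diagram:
  assumes p: "p permutes {..<n}" and n: "0 < n"
    and coeff: "coeff_of_mat (bitableau (P_tab (perm_mat n p)) (Q_tab (perm_mat n p))) (perm_mat n p) \<noteq> 0"
  obtains A where "A \<subseteq> {..<n}" "\<And>i j. i \<in> A \<Longrightarrow> j \<in> A \<Longrightarrow> i < j \<Longrightarrow> p j < p i"
    "\<And>k u. dec_in p k {..<n} u \<longleftrightarrow> k \<le> card {i \<in> A. p i < u}"
proof -
  define w where "w = map (\<lambda>j. Suc (p j)) [0..<n]"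
  have len: "length w = n" and nth: "\<And>i. i < n \<Longrightarrow> w ! i = Suc (p i)"
    by (simp_all add: w_def)
  have inj: "inj_on p {..<n}" using permutes_inj[OF p] by (rule inj_on_subset) simp
  then have dw: "distinct w" "0 \<notin> set w" "w \<noteq> []"
    using n by (auto simp: w_def distinct_map inj_on_def)
  have PQ: "P_tab (perm_mat n p) = tab w" "Q_tab (perm_mat n p) = snd (rsk w)"
    by (simp_all add: P_tab_def Q_tab_def perm_word_perm_mat[OF p] fst_rsk flip: w_def)
  obtain r where "tab w = r # tab (bumped w)" "r \<noteq> []" using tab_bumped[OF dw(1,3)] .
  then have "0 < num_columns (tab w)" by (simp add: num_columns_def)
  note nz = bitableau_coeff_nonzero[OF coeff[unfolded PQ] this]
  define A' where "A' = set (column (snd (rsk w)) 0)"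
  define B where "B = set (column (tab w) 0)"
  have A'1: "A' \<subseteq> {1..n}" using snd_rsk(4)[of w] by (simp add: A'_def len)
  have entry: "w ! (y - 1) = x" if xy: "Poly_Mapping.lookup (mat_exp (perm_mat n p)) (x, y) \<noteq> 0" for x y
  proof -
    obtain i j where ij: "i < dim_row (perm_mat n p)" "j < dim_col (perm_mat n p)" "x = Suc i" "y = Suc j"
      "perm_mat n p $$ (i, j) \<noteq> 0"
      using lookup_mat_exp_nonzero[OF xy] .
    then have "p j = i" "j < n" by (auto simp: perm_mat_def split: if_splits)
    then show ?thesis using ij(3,4) nth by simp
  qed
  have AB: "(\<lambda>i. w ! (i - 1)) ` A' = B"
  proof
    show "(\<lambda>i. w ! (i - 1)) ` A' \<subseteq> B"
      using nz(2) entry unfolding A'_def B_def by blast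
    show "B \<subseteq> (\<lambda>i. w ! (i - 1)) ` A'"
    proof
      fix x assume "x \<in> B"
      then obtain y where "y \<in> A'" "Poly_Mapping.lookup (mat_exp (perm_mat n p)) (x, y) \<noteq> 0"
        using nz(1) unfolding A'_def B_def by blast
      then show "x \<in> (\<lambda>i. w ! (i - 1)) ` A'" using entry by (intro image_eqI[of _ _ y]) auto
    qed
  qed
  note dec = first_columns_decreasing[OF dw(1,2) AB[unfolded A'_def B_def], folded A'_def]
  define A where "A = (\<lambda>i. i - 1) ` A'"
  have An: "A \<subseteq> {..<n}" using A'1 n by (force simp: A_def)
  have A'A: "Suc i \<in> A'" if i: "i \<in> A" for i
  proof -
    obtain i' where "i' \<in> A'" "i = i' - 1" using i by (auto simp: A_def)
    then show ?thesis using A'1 by (cases i') auto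
  qed
  have card_eq: "card {i \<in> A. p i < u} = card {i \<in> A'. w ! (i - 1) \<le> u}" for u
  proof (rule bij_betw_same_card)
    show "bij_betw Suc {i \<in> A. p i < u} {i \<in> A'. w ! (i - 1) \<le> u}"
      unfolding bij_betw_def
    proof
      show "Suc ` {i \<in> A. p i < u} = {i \<in> A'. w ! (i - 1) \<le> u}"
      proof
        show "Suc ` {i \<in> A. p i < u} \<subseteq> {i \<in> A'. w ! (i - 1) \<le> u}"
          using A'A An nth by auto
        show "{i \<in> A'. w ! (i - 1) \<le> u} \<subseteq> Suc ` {i \<in> A. p i < u}"
        proof
          fix i assume i: "i \<in> {i \<in> A'. w ! (i - 1) \<le> u}"
          then have "i - 1 \<in> A" "i \<ge> 1" using A'1 by (auto simp: A_def)
          moreover have "i - 1 < n" using \<open>i - 1 \<in> A\<close> An by blast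
          ultimately have "i - 1 \<in> {i \<in> A. p i < u}" "i = Suc (i - 1)" using i nth[of "i - 1"] by auto
          then show "i \<in> Suc ` {i \<in> A. p i < u}" by (rule rev_image_eqI)
        qed
      qed
    qed simp
  qed
  have wle: "w ! i \<le> u \<longleftrightarrow> p i < u" if "i < n" for i u
    using nth[OF that] by auto
  have wlt: "w ! j < w ! i \<longleftrightarrow> p j < p i" if "i < n" "j < n" for i j
    using nth that by simp
  have dec_iff: "dec_in p k {..<n} u \<longleftrightarrow> has_dec k (filter (\<lambda>x. x \<le> u) w)" for k u
  proof
    assume "dec_in p k {..<n} u"
    then obtain I where I: "I \<subseteq> {..<n}" "card I = k" "p ` I \<subseteq> {..<u}"
      "\<forall>i\<in>I. \<forall>j\<in>I. p i < p j \<longleftrightarrow> j < i" unfolding dec_in_def by blast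
    have lt: "i < n" if "i \<in> I" for i using I(1) that by auto
    have "\<forall>i\<in>I. w ! i \<le> u" using I(3) lt wle by blast
    moreover have "\<forall>i\<in>I. \<forall>j\<in>I. i < j \<longrightarrow> w ! j < w ! i" using I(4) lt wlt by blast
    ultimately show "has_dec k (filter (\<lambda>x. x \<le> u) w)"
      unfolding has_dec_filter_iff len using I(1,2) by (intro exI[of _ I]) simp
  next
    assume "has_dec k (filter (\<lambda>x. x \<le> u) w)"
    then obtain I where I: "I \<subseteq> {..<n}" "card I = k" "\<forall>i\<in>I. w ! i \<le> u"
      "\<forall>i\<in>I. \<forall>j\<in>I. i < j \<longrightarrow> w ! j < w ! i"
      unfolding has_dec_filter_iff len by blast
    have lt: "i < n" if "i \<in> I" for i using I(1) that by auto
    have "p ` I \<subseteq> {..<u}" using I(3) lt wle by blast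
    moreover have "\<forall>i\<in>I. \<forall>j\<in>I. i < j \<longrightarrow> p j < p i" using I(4) lt wlt by blast
    ultimately show "dec_in p k {..<n} u"
      using I(1,2) by (intro dec_inI[of I]) simp_all
  qed
  show ?thesis
  proof (rule that[OF An])
    show "p j < p i" if ij: "i \<in> A" "j \<in> A" "i < j" for i j
    proof -
      have "w ! (Suc j - 1) < w ! (Suc i - 1)" using dec(1)[OF A'A[OF ij(1)] A'A[OF ij(2)]] ij(3) by simp
      moreover have "i < n" "j < n" using ij(1,2) An by auto
      ultimately show ?thesis using wlt by simp
    qed
    show "dec_in p k {..<n} u \<longleftrightarrow> k \<le> card {i \<in> A. p i < u}" for k u
      using schensted_rows[of "filter (\<lambda>x. x \<le> u) w" k] dw(1) dec(2)[of u] card_eq[of u] dec_iff[of k u]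
      by simp
  qed
qed

lemma pow_half_le:
  fixes x :: real
  assumes "0 \<le> x" "x \<le> 1 / 2" "q \<le> k"
  shows "x ^ k \<le> 1 / 2 ^ q"
proof -
  have "x ^ k \<le> (1 / 2) ^ k" using assms by (intro power_mono) auto
  also have "\<dots> \<le> (1 / 2) ^ q" using assms by (intro power_decreasing) auto
  finally show ?thesis by (simp add: power_one_over)
qed

text \<open>A union bound over long decreasing (\<open>D\<close>) and increasing (\<open>I\<close>)
  patterns in the values below \<open>v j\<close> and decreasing patterns in short windows
  (\<open>W\<close>), each of probability at most \<open>1 / 2 ^ q\<close>. Outside these events a
  nonzero coefficient contradicts \<open>decreasing_diagram_impossible\<close>. The variable
  \<open>R\<close> keeps \<open>72 ^ Suc R\<close> symbolic.\<close>

lemma card_coeff_nonzero_le: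
  fixes n q R :: nat
  assumes R: "R = 5184" and q: "0 < q" and nq: "144 * (q * 72 ^ Suc R)\<^sup>2 \<le> n" and nR: "R \<le> n"
  shows "real (card {p. p permutes {..<n} \<and>
      coeff_of_mat (bitableau (P_tab (perm_mat n p)) (Q_tab (perm_mat n p))) (perm_mat n p) \<noteq> 0})
    \<le> fact n * ((2 * (real R + 2) + (real R + 1) * real n) / 2 ^ q)" (is "real (card ?G) \<le> _")
proof -
  have n: "0 < n" using R nR by simp
  \<comment> \<open>The lengths decrease by factors of 72 down to \<open>q\<close> at
    \<open>j = Suc R\<close>. With this \<open>v\<close>, the quantity \<open>9 * v j / k^2\<close>
    in \<open>card_pattern_bound\<close> is 1/4 for \<open>k = 72 * qq j\<close> and 1296 for
    \<open>k = qq j\<close>.\<close>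
  define qq where "qq = (\<lambda>j. q * 72 ^ (Suc R - j))"
  define v where "v = (\<lambda>j. 144 * (qq j)\<^sup>2)"
  \<comment> \<open>A window must have \<open>m / n\<close> at most 1/2592 to bring the base 1296
    down to 1/2. \<open>R\<close> is twice 2592, which leaves room for the rounding in
    \<open>m\<close>.\<close>
  define m where "m = n div R + 1"
  have qq_pos: "0 < qq j" and q_le: "q \<le> qq j" for j using q by (simp_all add: qq_def)
  have qq_Suc: "qq j = 72 * qq (Suc j)" if "j \<le> R" for j
    using that by (simp add: qq_def Suc_diff_le)
  have "qq j \<le> q * 72 ^ Suc R" for j
    unfolding qq_def by (intro mult_le_mono2 power_increasing) auto
  then have "(qq j)\<^sup>2 \<le> (q * 72 ^ Suc R)\<^sup>2" for j by (intro power_mono) auto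
  then have v_le: "v j \<le> n" for j using nq unfolding v_def by (meson le_trans mult_le_mono2)
  have qq72: "72 * qq j \<le> n" for j
  proof -
    have "qq j \<le> (qq j)\<^sup>2" using qq_pos[of j] by (simp add: power2_eq_square)
    then show ?thesis using v_le[of j] unfolding v_def by linarith
  qed
  have nm: "n \<le> R * m"
    unfolding m_def using R dividend_less_times_div[of R n] by simp
  have "real (n div R) \<le> real n / real R" by (rule of_nat_div_le_of_nat)
  then have "real m \<le> real n / 5184 + 1" by (simp add: m_def R)
  also have "\<dots> \<le> real n / 2592" using nR R by simp
  finally have m_ratio: "real m \<le> real n / 2592" .
  then have mn: "m \<le> n" by simp
  define D where "D = (\<lambda>j. {p. p permutes {..<n} \<and> dec_in p (72 * qq j) {..<n} (v j)})"
  define I where "I = (\<lambda>j. {p. p permutes {..<n} \<and> inc_in p (72 * qq j) {..<n} (v j)})"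
  define W where "W = (\<lambda>j a. {p. p permutes {..<n} \<and> dec_in p (qq j) ({a..<a + m} \<inter> {..<n}) (v j)})"
  have ratio: "9 * real (v j) / (real (72 * qq j))\<^sup>2 = 1 / 4" "9 * real (v j) / (real (qq j))\<^sup>2 = 1296" for j
    using qq_pos[of j] by (simp_all add: v_def power_mult_distrib)
  have D: "real (card (D j)) \<le> fact n / 2 ^ q" for j
  proof -
    have "real (card (D j)) \<le> fact n * (real n / real n * (9 * real (v j) / (real (72 * qq j))\<^sup>2)) ^ (72 * qq j)"
      unfolding D_def dec_in_def using qq72 qq_pos by (intro card_pattern_bound) auto
    also have "\<dots> = fact n * (1 / 4) ^ (72 * qq j)" using n by (simp only: ratio) simp
    also have "\<dots> \<le> fact n * (1 / 2 ^ q)"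
      using q_le[of j] by (intro mult_left_mono pow_half_le) auto
    finally show ?thesis by simp
  qed
  have I: "real (card (I j)) \<le> fact n / 2 ^ q" for j
  proof -
    have "real (card (I j)) \<le> fact n * (real n / real n * (9 * real (v j) / (real (72 * qq j))\<^sup>2)) ^ (72 * qq j)"
      unfolding I_def inc_in_def using qq72 qq_pos by (intro card_pattern_bound) auto
    also have "\<dots> = fact n * (1 / 4) ^ (72 * qq j)" using n by (simp only: ratio) simp
    also have "\<dots> \<le> fact n * (1 / 2 ^ q)"
      using q_le[of j] by (intro mult_left_mono pow_half_le) auto
    finally show ?thesis by simp
  qed
  have W: "real (card (W j a)) \<le> fact n / 2 ^ q" for j a
  proof -
    have "card ({a..<a + m} \<inter> {..<n}) \<le> card {a..<a + m}" by (intro card_mono) auto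
    then have "real (card (W j a)) \<le> fact n * (real m / real n * (9 * real (v j) / (real (qq j))\<^sup>2)) ^ qq j"
      unfolding W_def dec_in_def using qq72[of j] qq_pos[of j] mn by (intro card_pattern_bound) auto
    also have "\<dots> = fact n * (real m / real n * 1296) ^ qq j" by (simp only: ratio)
    also have "\<dots> \<le> fact n * (1 / 2 ^ q)"
      using q_le[of j] m_ratio n by (intro mult_left_mono pow_half_le) (auto simp: field_simps)
    finally show ?thesis by simp
  qed
  have "?G \<subseteq> (\<Union>j\<le>Suc R. D j \<union> I j) \<union> (\<Union>j\<le>R. \<Union>a<n. W j a)"
  proof
    fix p assume p: "p \<in> ?G"
    then have pp: "p permutes {..<n}" by simp
    obtain A where A: "A \<subseteq> {..<n}" "\<And>i j. i \<in> A \<Longrightarrow> j \<in> A \<Longrightarrow> i < j \<Longrightarrow> p j < p i"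
      "\<And>k u. dec_in p k {..<n} u \<longleftrightarrow> k \<le> card {i \<in> A. p i < u}"
      using p first_column_diagram[OF pp n] by blast
    show "p \<in> (\<Union>j\<le>Suc R. D j \<union> I j) \<union> (\<Union>j\<le>R. \<Union>a<n. W j a)"
    proof (rule ccontr)
      assume neg: "p \<notin> (\<Union>j\<le>Suc R. D j \<union> I j) \<union> (\<Union>j\<le>R. \<Union>a<n. W j a)"
      show False
      proof (rule decreasing_diagram_impossible[OF permutes_imp_bij[OF pp] A])
        show "\<not> dec_in p (72 * qq j) {..<n} (v j)" if "j \<le> Suc R" for j
          using neg that pp by (auto simp: D_def)
        show "\<not> inc_in p (72 * qq j) {..<n} (v j)" if "j \<le> Suc R" for j
          using neg that pp by (auto simp: I_def)
        show "\<not> dec_in p (qq j) ({a..<a + m} \<inter> {..<n}) (v j)" if "j \<le> R" "a < n" for j a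
          using neg that pp by (auto simp: W_def)
      qed (use v_le qq_pos qq_Suc nm in \<open>auto simp: v_def\<close>)
    qed
  qed
  moreover have "finite {p. p permutes {..<n}}" by (simp add: finite_permutations)
  then have fin: "finite (D j)" "finite (I j)" "finite (W j a)" for j a
    by (auto simp: D_def I_def W_def elim: finite_subset[rotated])
  ultimately have "card ?G \<le> card ((\<Union>j\<le>Suc R. D j \<union> I j) \<union> (\<Union>j\<le>R. \<Union>a<n. W j a))"
    by (intro card_mono) auto
  also have "\<dots> \<le> card (\<Union>j\<le>Suc R. D j \<union> I j) + card (\<Union>j\<le>R. \<Union>a<n. W j a)" by (rule card_Un_le)
  also have "\<dots> \<le> (\<Sum>j\<le>Suc R. card (D j \<union> I j)) + (\<Sum>j\<le>R. card (\<Union>a<n. W j a))"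
    by (intro add_mono card_UN_le) auto
  also have "\<dots> \<le> (\<Sum>j\<le>Suc R. card (D j) + card (I j)) + (\<Sum>j\<le>R. \<Sum>a<n. card (W j a))"
    by (intro add_mono sum_mono card_Un_le card_UN_le) auto
  finally have "real (card ?G) \<le> real ((\<Sum>j\<le>Suc R. card (D j) + card (I j)) + (\<Sum>j\<le>R. \<Sum>a<n. card (W j a)))"
    by (simp only: of_nat_le_iff)
  also have "\<dots> = (\<Sum>j\<le>Suc R. real (card (D j)) + real (card (I j))) + (\<Sum>j\<le>R. \<Sum>a<n. real (card (W j a)))"
    by (simp only: of_nat_add of_nat_sum)
  also have "\<dots> \<le> (\<Sum>j\<le>Suc R. fact n / 2 ^ q + fact n / 2 ^ q) + (\<Sum>j\<le>R. \<Sum>a<n. fact n / 2 ^ q)"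
    using D I W by (intro add_mono sum_mono) auto
  also have "\<dots> = (real R + 2) * (fact n / 2 ^ q + fact n / 2 ^ q) + (real R + 1) * (real n * (fact n / 2 ^ q))"
    by (simp only: sum_constant card_atMost card_lessThan of_nat_Suc) (simp add: algebra_simps)
  also have "\<dots> = fact n * ((2 * (real R + 2) + (real R + 1) * real n) / 2 ^ q)"
    by (simp add: field_simps)
  finally show ?thesis .
qed

section \<open>Passage to the limit\<close>

lemma card_C:
  "real (card (C n)) = fact n - real (card {p. p permutes {..<n} \<and>
      coeff_of_mat (bitableau (P_tab (perm_mat n p)) (Q_tab (perm_mat n p))) (perm_mat n p) \<noteq> 0})"
proof -
  let ?c = "\<lambda>\<alpha>. coeff_of_mat (bitableau (P_tab \<alpha>) (Q_tab \<alpha>)) \<alpha>"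
  let ?P = "{p. p permutes {..<n}}" and ?G = "{p. p permutes {..<n} \<and> ?c (perm_mat n p) \<noteq> 0}"
  have "C n = perm_mat n ` (?P - ?G)"
  proof
    show "C n \<subseteq> perm_mat n ` (?P - ?G)"
    proof
      fix \<alpha> assume a: "\<alpha> \<in> C n"
      then obtain p where p: "p permutes {..<n}" "\<alpha> = perm_mat n p"
        using perm_mat_surj[of \<alpha> n] by (auto simp: C_def)
      then have "p \<in> ?P - ?G" using a by (simp add: C_def)
      then show "\<alpha> \<in> perm_mat n ` (?P - ?G)" using p(2) by blast
    qed
    show "perm_mat n ` (?P - ?G) \<subseteq> C n"
      using perm_mat_in by (auto simp: C_def)
  qed
  moreover have "inj_on (perm_mat n) (?P - ?G)" using perm_mat_inj by (rule inj_on_subset) auto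
  ultimately have "card (C n) = card (?P - ?G)" by (simp add: card_image)
  also have "\<dots> = card ?P - card ?G"
    by (intro card_Diff_subset) (auto intro: finite_subset[OF _ finite_permutations[of "{..<n}"]])
  finally have "card (C n) = card ?P - card ?G" .
  moreover have "card ?G \<le> card ?P" by (intro card_mono) (auto simp: finite_permutations)
  moreover have "card ?P = fact n" by (intro card_permutations) auto
  ultimately show ?thesis by simp
qed

theorem theorem1p3:
  shows "(\<lambda>n. real (card (C n)) / fact n) \<longlonglongrightarrow> 1"
proof -
  define R :: nat where "R = 5184"
  \<comment> \<open>As 12 is the square root of 144, the size condition of
    \<open>card_coeff_nonzero_le\<close> reads \<open>q * K \<le> sqrt n\<close>, so
    \<open>q\<close> may be the floor of \<open>sqrt n / K\<close>.\<close>
  define K :: real where "K = 12 * 72 ^ Suc R"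
  \<comment> \<open>Replacing the floor \<open>q\<close> by \<open>sqrt n / K\<close> costs at most
    the extra factor 2. The exponential in \<open>sqrt n\<close> outweighs the linear
    factor.\<close>
  define b where "b = (\<lambda>n. (2 * (real R + 2) + (real R + 1) * real n) * (2 * 2 powr (- (sqrt (real n) / K))))"
  have K: "0 < K" by (simp add: K_def)
  have lower: "1 - b n \<le> real (card (C n)) / fact n" if nR: "R \<le> n" and nK: "K \<le> sqrt (real n)" for n
  proof -
    define q where "q = nat \<lfloor>sqrt (real n) / K\<rfloor>"
    have "1 \<le> sqrt (real n) / K" using nK K by simp
    then have q: "0 < q" by (simp add: q_def)
    have qle: "real q \<le> sqrt (real n) / K" using K by (simp add: q_def)
    then have "real q * K \<le> sqrt (real n)" using K by (simp add: field_simps)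
    then have "(real q * K)\<^sup>2 \<le> real n" using K by (metis mult_nonneg_nonneg of_nat_0_le_iff less_imp_le sqrt_le_D real_le_rsqrt power_mono real_sqrt_pow2)
    then have "real (144 * (q * 72 ^ Suc R)\<^sup>2) \<le> real n"
      by (simp add: K_def power_mult_distrib mult.commute mult.left_commute del: power_Suc)
    then have nq: "144 * (q * 72 ^ Suc R)\<^sup>2 \<le> n" by (simp only: of_nat_le_iff)
    have "1 / 2 ^ q \<le> 2 * 2 powr (- (sqrt (real n) / K))"
    proof -
      have "sqrt (real n) / K \<le> real q + 1" unfolding q_def by linarith
      then have le: "2 powr (- (real q + 1)) \<le> 2 powr (- (sqrt (real n) / K))" by simp
      have eq: "2 powr (- (real q + 1)) = 1 / 2 ^ q / (2::real)"
        by (simp only: powr_minus_divide powr_add powr_realpow powr_one) simp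
      have "1 / 2 ^ q = 2 * (1 / 2 ^ q / (2::real))" by simp
      also have "\<dots> \<le> 2 * 2 powr (- (sqrt (real n) / K))"
        using le[unfolded eq] by (rule mult_left_mono) simp
      finally show ?thesis .
    qed
    then have "(2 * (real R + 2) + (real R + 1) * real n) * (1 / 2 ^ q) \<le> b n"
      unfolding b_def by (rule mult_left_mono) simp
    then have b: "(2 * (real R + 2) + (real R + 1) * real n) / 2 ^ q \<le> b n" by simp
    define g where "g = real (card {p. p permutes {..<n} \<and>
      coeff_of_mat (bitableau (P_tab (perm_mat n p)) (Q_tab (perm_mat n p))) (perm_mat n p) \<noteq> 0})"
    have "g \<le> fact n * ((2 * (real R + 2) + (real R + 1) * real n) / 2 ^ q)"
      unfolding g_def using card_coeff_nonzero_le[OF R_def q nq nR] .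
    also have "\<dots> \<le> fact n * b n" using b by (rule mult_left_mono) simp
    finally have "g / fact n \<le> b n" by (simp add: pos_divide_le_eq mult.commute)
    moreover have "real (card (C n)) / fact n = 1 - g / fact n"
      unfolding card_C g_def by (simp add: diff_divide_distrib)
    ultimately show ?thesis by simp
  qed
  have "filterlim (\<lambda>n. sqrt (real n)) at_top sequentially" by real_asymp
  then have "eventually (\<lambda>n. K \<le> sqrt (real n)) sequentially" by (simp add: filterlim_at_top)
  then have ev: "eventually (\<lambda>n. 1 - b n \<le> real (card (C n)) / fact n) sequentially"
    using eventually_ge_at_top[of R] by eventually_elim (rule lower)
  have "b \<longlonglongrightarrow> 0" unfolding b_def using K by real_asymp
  then have "(\<lambda>n. 1 - b n) \<longlonglongrightarrow> 1 - 0" by (intro tendsto_diff tendsto_const)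
  then have lim: "(\<lambda>n. 1 - b n) \<longlonglongrightarrow> 1" by simp
  have "real (card (C n)) / fact n \<le> 1" for n by (simp add: card_C)
  then have "eventually (\<lambda>n. real (card (C n)) / fact n \<le> 1) sequentially" by (rule always_eventually[OF allI])
  then show ?thesis by (rule tendsto_sandwich[OF ev _ lim tendsto_const])
qed

end
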